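(* Let $|||\cdot|||$ be any unitarily invariant norm on the space of $n\times n$ complex matrices, and let $\|\cdot\|$ be the operator norm. For all $n\times n$ complex positive definite matrices $A,B$, $$|||\mathrm{D}G(A,B)|||\leq\left(\int_0^{\infty}\left\|e^{-t(A^{-1}B)^{1/2}}\right\|^2dt\right)\left(1+\left\|(A^{-1}B)^{1/2}\right\|^2\right),$$ where $G(A,B)=A\#B$ is the geometric mean map.
   Context: For $A,B$ complex positive definite (Hermitian), the geometric mean is $A\#B=A^{1/2}(A^{-1/2}BA^{-1/2})^{1/2}A^{1/2}$. The matrix $A^{-1}B$ has positive eigenvalues and $(A^{-1}B)^{1/2}$ denotes its unique square root with positive eigenvalues. The derivative is the linear map $\mathrm{D}G(A,B)(X,Y)=\left.\frac{d}{dt}\right|_{t=0}G(A+tX,B+tY)$ for $X,Y$ in the space of $n\times n$ complex Hermitian matrices. A norm is unitarily invariant if $|||UAV|||=|||A|||$ for all matrices $A$ and all unitary $U,V$. The norm of the derivative is $|||\mathrm{D}G(A,B)|||=\sup\{|||\mathrm{D}G(A,B)(X,Y)|||:\ X,Y \text{ Hermitian},\ |||(X,Y)|||=1\}$, where $|||(X,Y)|||=\max\{|||X|||,|||Y|||\}$. *)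

theory Defs
  imports "HOL-Analysis.Analysis"
begin

definition conj_transpose :: "complex^'n^'n \<Rightarrow> complex^'n^'n" where
  "conj_transpose A = (\<chi> i j. cnj (A $ j $ i))"

definition hermitian_mat :: "complex^'n^'n \<Rightarrow> bool" where
  "hermitian_mat A \<longleftrightarrow> conj_transpose A = A"

definition unitary_mat :: "complex^'n^'n \<Rightarrow> bool" where
  "unitary_mat U \<longleftrightarrow> conj_transpose U ** U = mat 1 \<and> U ** conj_transpose U = mat 1"

text \<open>The quadratic form of a Hermitian matrix is real, so taking the real part loses nothing.\<close>

definition pos_def_mat :: "complex^'n^'n \<Rightarrow> bool" where
  "pos_def_mat A \<longleftrightarrow>
     hermitian_mat A \<and> (\<forall>x. x \<noteq> 0 \<longrightarrow> 0 < Re (\<Sum>i\<in>UNIV. cnj (x $ i) * (A *v x) $ i))"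

definition eigenvalue_mat :: "complex^'n^'n \<Rightarrow> complex \<Rightarrow> bool" where
  "eigenvalue_mat A l \<longleftrightarrow> (\<exists>v. v \<noteq> 0 \<and> A *v v = l *s v)"

text \<open>The positive definite square root; it exists and is unique for positive definite \<open>A\<close>.\<close>

definition pd_sqrt :: "complex^'n^'n \<Rightarrow> complex^'n^'n" where
  "pd_sqrt A = (THE S. pos_def_mat S \<and> S ** S = A)"

text \<open>The square root all of whose eigenvalues are positive reals. It exists and is unique for any
  matrix with positive eigenvalues, Hermitian or not, in particular for \<open>A\<^sup>-\<^sup>1 B\<close> with \<open>A\<close> and
  \<open>B\<close> positive definite.\<close>

definition pos_eig_sqrt :: "complex^'n^'n \<Rightarrow> complex^'n^'n" where
  "pos_eig_sqrt M =
     (THE S. S ** S = M \<and> (\<forall>l. eigenvalue_mat S l \<longrightarrow> (\<exists>r::real. 0 < r \<and> l = of_real r)))"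

definition geom_mean :: "complex^'n^'n \<Rightarrow> complex^'n^'n \<Rightarrow> complex^'n^'n" where
  "geom_mean A B =
     pd_sqrt A ** pd_sqrt (matrix_inv (pd_sqrt A) ** B ** matrix_inv (pd_sqrt A)) ** pd_sqrt A"

text \<open>The library's \<open>*\<close>, \<open>^\<close> and \<open>1\<close> on vectors act componentwise and are not the matrix operations,
  hence the explicit power and exponential series.\<close>

primrec mat_power :: "complex^'n^'n \<Rightarrow> nat \<Rightarrow> complex^'n^'n" where
  "mat_power A 0 = mat 1"
| "mat_power A (Suc k) = A ** mat_power A k"

definition mat_exp :: "complex^'n^'n \<Rightarrow> complex^'n^'n" where
  "mat_exp A = (\<Sum>k. (1 / fact k) *\<^sub>R mat_power A k)"

text \<open>The operator norm induced by the Euclidean norm of \<open>complex^'n\<close>; the instance \<open>norm\<close> on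
  \<open>complex^'n^'n\<close> is the Frobenius norm.\<close>

definition op_norm :: "complex^'n^'n \<Rightarrow> real" where
  "op_norm A = onorm ((*v) A)"

definition matrix_norm :: "(complex^'n^'n \<Rightarrow> real) \<Rightarrow> bool" where
  "matrix_norm N \<longleftrightarrow>
     (\<forall>A. 0 \<le> N A) \<and>
     (\<forall>A. N A = 0 \<longleftrightarrow> A = 0) \<and>
     (\<forall>c A. N (\<chi> i j. c * A $ i $ j) = cmod c * N A) \<and>
     (\<forall>A B. N (A + B) \<le> N A + N B)"

definition unitarily_invariant_norm :: "(complex^'n^'n \<Rightarrow> real) \<Rightarrow> bool" where
  "unitarily_invariant_norm N \<longleftrightarrow>
     matrix_norm N \<and>
     (\<forall>A U V. unitary_mat U \<longrightarrow> unitary_mat V \<longrightarrow> N (U ** A ** V) = N A)"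

definition mat_deriv ::
  "(complex^'n^'n \<Rightarrow> complex^'n^'n \<Rightarrow> complex^'n^'n) \<Rightarrow> complex^'n^'n \<Rightarrow> complex^'n^'n \<Rightarrow>
   complex^'n^'n \<Rightarrow> complex^'n^'n \<Rightarrow> complex^'n^'n" where
  "mat_deriv F A B X Y =
     vector_derivative (\<lambda>t::real. F (A + t *\<^sub>R X) (B + t *\<^sub>R Y)) (at 0)"

definition mat_deriv_norm ::
  "(complex^'n^'n \<Rightarrow> real) \<Rightarrow> (complex^'n^'n \<Rightarrow> complex^'n^'n \<Rightarrow> complex^'n^'n) \<Rightarrow>
   complex^'n^'n \<Rightarrow> complex^'n^'n \<Rightarrow> real" where
  "mat_deriv_norm N F A B =
     Sup {N (mat_deriv F A B X Y) | X Y.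
            hermitian_mat X \<and> hermitian_mat Y \<and> max (N X) (N Y) = 1}"

end

theory Submission
  imports Defs
begin

text \<open>Put \<open>G = A # B\<close> and \<open>S = A\<^sup>-\<^sup>1 G\<close>. Then \<open>S\<^sup>2 = A\<^sup>-\<^sup>1 B\<close>, and \<open>S\<close> is similar to a positive
  definite matrix, so \<open>S = (A\<^sup>-\<^sup>1 B)\<^sup>1\<^sup>/\<^sup>2\<close>. Differentiating the Riccati equation \<open>G A\<^sup>-\<^sup>1 G = B\<close> shows that
  the derivative \<open>D\<close> in direction \<open>(X, Y)\<close> solves \<open>S\<^sup>* D + D S = R\<close> with \<open>R = Y + S\<^sup>* X S\<close>. The curve
  \<open>exp (- t S\<^sup>*) D exp (- t S)\<close> decays to 0 and has derivative \<open>- exp (- t S\<^sup>*) R exp (- t S)\<close>, so \<open>D\<close>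
  is the integral of \<open>exp (- t S\<^sup>*) R exp (- t S)\<close> over the half-line. The bound follows because a unitarily invariant norm
  satisfies \<open>N (Z\<^sup>* X Z) \<le> \<parallel>Z\<parallel>\<^sup>2 N X\<close>: an invertible contraction is the mean of two unitaries.\<close>

section \<open>Self-adjoint operators and the spectral theorem\<close>

text \<open>\<open>mat_deriv\<close> takes its value from a choice operator, so differentiability of
  \<open>geom_mean\<close> along every Hermitian direction has to be proved, not assumed. It is
  extracted from the Riccati equation itself: subtracting the equations at t and at 0 gives an exact
  equation for the difference quotient, namely the Sylvester equation with a perturbation that
  vanishes as t tends to 0. Injectivity of the Sylvester operator then forces the quotient to
  converge; the analytic input is continuity of \<open>geom_mean\<close>, hence of
  \<open>pd_sqrt\<close> and \<open>matrix_inv\<close>. The second obstacle is that S is in general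
  not normal. The functional calculus therefore rests on idempotents that need not be orthogonal
  projections, a class stable under similarity; it yields the square root, the exponential and its
  decay. The norm N is not the type class norm, so limits and integrals reach it only through
  subadditivity, homogeneity and domination by \<open>norm\<close>. The factor
  \<open>1 + \<parallel>S\<parallel>\<^sup>2\<close> bounds N R: Y contributes 1, and the congruence
  \<open>S\<^sup>* X S\<close> contributes the square.\<close>

lemma self_adjoint_eigenvector:
  fixes f :: "'a::euclidean_space \<Rightarrow> 'a"
  assumes lin: "linear f" and sa: "\<And>x y. x \<bullet> f y = f x \<bullet> y"
    and V: "subspace V" "V \<noteq> {0}" and inv: "f ` V \<subseteq> V"
  obtains v l where "v \<in> V" "norm v = 1" "f v = l *\<^sub>R v" "\<And>x. x \<in> V \<Longrightarrow> x \<bullet> f x \<le> l * (x \<bullet> x)"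
proof -
  define K where "K = V \<inter> sphere 0 1"
  obtain u where u: "u \<in> V" "u \<noteq> 0"
    using V subspace_0 by blast
  have "u /\<^sub>R norm u \<in> K"
    using u V by (simp add: K_def subspace_scale)
  moreover have "compact K"
    unfolding K_def using V(1) closed_Int_compact closed_subspace compact_sphere by blast
  moreover have "continuous_on K (\<lambda>x. x \<bullet> f x)"
    using lin by (intro continuous_intros linear_continuous_on linear_linear[THEN iffD1]) (simp add: linear_conv_bounded_linear)
  ultimately obtain v where v: "v \<in> K" and max: "\<And>x. x \<in> K \<Longrightarrow> x \<bullet> f x \<le> v \<bullet> f v"
    using continuous_attains_sup[of K "\<lambda>x. x \<bullet> f x"] by blast
  define l where "l = v \<bullet> f v"
  interpret f: linear f by fact
  have vV: "v \<in> V" "norm v = 1" using v by (auto simp: K_def)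
  have bound: "x \<bullet> f x \<le> l * (x \<bullet> x)" if "x \<in> V" for x
  proof (cases "x = 0")
    case False
    have "x /\<^sub>R norm x \<in> K"
      using that False V by (simp add: K_def subspace_scale)
    from max[OF this] have "(x \<bullet> f x) / (norm x * norm x) \<le> l"
      by (simp add: f.scale l_def divide_inverse mult_ac)
    then show ?thesis
      using False by (simp add: field_simps dot_square_norm power2_eq_square)
  qed simp
  define w where "w = l *\<^sub>R v - f v"
  have wV: "w \<in> V" using vV inv V unfolding w_def by (auto intro!: subspace_diff subspace_scale)
  have vv: "v \<bullet> v = 1" using vV by (simp add: dot_square_norm)
  have vw: "v \<bullet> w = 0" by (simp add: w_def inner_diff_right vv l_def)
  \<comment> \<open>The form \<open>l - f\<close> is nonnegative on \<open>V\<close> and vanishes at \<open>v\<close>, so \<open>v\<close> is in its kernel: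
    otherwise a small step from \<open>v\<close> against \<open>w = (l - f) v\<close> would make the form negative.\<close>
  have "w = 0"
  proof (rule ccontr)
    assume "w \<noteq> 0"
    define c where "c = l * (w \<bullet> w) - w \<bullet> f w"
    have c: "c \<ge> 0" using bound[OF wV] by (simp add: c_def)
    have key: "2 * s * (w \<bullet> w) \<le> s\<^sup>2 * c" for s
    proof -
      have "v - s *\<^sub>R w \<in> V" using vV wV V by (simp add: subspace_diff subspace_scale)
      from bound[OF this] have "v \<bullet> f v - s * (v \<bullet> f w) - s * (w \<bullet> f v) + s\<^sup>2 * (w \<bullet> f w)
          \<le> l * (1 + s\<^sup>2 * (w \<bullet> w))"
        by (simp add: f.diff f.scale inner_diff_left inner_diff_right vv vw inner_commute[of w v]
            power2_eq_square algebra_simps)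
      moreover have "v \<bullet> f w = - (w \<bullet> w)" "w \<bullet> f v = - (w \<bullet> w)"
        using vw sa[of v w] by (simp_all add: w_def inner_diff_left inner_diff_right inner_commute)
      ultimately show ?thesis by (simp add: c_def l_def algebra_simps)
    qed
    have ww: "w \<bullet> w > 0" using \<open>w \<noteq> 0\<close> by simp
    \<comment> \<open>This choice keeps \<open>s * c\<close> at most \<open>w \<bullet> w\<close>,
      while \<open>key\<close> demands at least twice that. Adding 1 to c avoids dividing by
      0.\<close>
    define s where "s = (w \<bullet> w) / (c + 1)"
    have s: "s > 0" using ww c by (simp add: s_def)
    have "2 * (w \<bullet> w) \<le> s * c"
      using key[of s] s by (simp add: power2_eq_square mult.assoc)
    also have "s * c \<le> w \<bullet> w"
      using c ww unfolding s_def by (simp add: field_simps)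
    finally show False using ww by simp
  qed
  then show ?thesis using that[of v l] vV bound by (simp add: w_def)
qed

text \<open>An orthonormal family of eigenvectors of maximal size must span: by self-adjointness its
  orthogonal complement V is invariant under f, and if V were nonzero it would contain one more unit
  eigenvector.\<close>

lemma self_adjoint_eigenbasis:
  fixes f :: "'a::euclidean_space \<Rightarrow> 'a"
  assumes lin: "linear f" and sa: "\<And>x y. x \<bullet> f y = f x \<bullet> y"
  obtains B l where "finite B" "pairwise orthogonal B" "\<And>b. b \<in> B \<Longrightarrow> norm b = 1"
    "span B = UNIV" "\<And>b. b \<in> B \<Longrightarrow> f b = l b *\<^sub>R b"
proof -
  interpret f: linear f by fact
  define P where "P B \<longleftrightarrow> pairwise orthogonal B \<and> (\<forall>b\<in>B. norm b = 1 \<and> (\<exists>l. f b = l *\<^sub>R b))" for B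
  have fin: "finite B \<and> card B \<le> DIM('a)" if "P B" for B
  proof -
    have "0 \<notin> B" using that by (force simp: P_def)
    then have "independent B" using that by (intro pairwise_orthogonal_independent) (auto simp: P_def)
    then show ?thesis using independent_bound by blast
  qed
  have "P {}" by (simp add: P_def)
  then obtain B where B: "P B" and max: "\<And>C. P C \<Longrightarrow> card C \<le> card B"
    using ex_has_greatest_nat[of P "{}" card "DIM('a) + 1"] fin by (metis le_imp_less_Suc Suc_eq_plus1)
  have "span B = UNIV"
  proof (rule ccontr)
    assume ne: "span B \<noteq> UNIV"
    define V where "V = {x. \<forall>b\<in>B. orthogonal b x}"
    have V: "subspace V"
      unfolding V_def by (auto simp: subspace_def orthogonal_def inner_add_right)
    obtain u where u: "u \<noteq> 0" "\<And>y. y \<in> span B \<Longrightarrow> orthogonal u y"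
      using orthogonal_to_subspace_exists_gen[of B UNIV] ne by auto
    then have "u \<in> V" by (auto simp: V_def orthogonal_commute span_base)
    then have ne0: "V \<noteq> {0}" using u by blast
    have "f ` V \<subseteq> V"
    proof clarify
      fix x assume "x \<in> V"
      show "f x \<in> V" unfolding V_def
      proof clarify
        fix b assume b: "b \<in> B"
        then obtain l where "f b = l *\<^sub>R b" using B by (auto simp: P_def)
        then show "orthogonal b (f x)"
          using sa[of b x] \<open>x \<in> V\<close> b by (auto simp: V_def orthogonal_def)
      qed
    qed
    then obtain v l where v: "v \<in> V" "norm v = 1" "f v = l *\<^sub>R v"
      by (rule self_adjoint_eigenvector[OF lin sa V ne0]) (rule that)
    have "v \<notin> B"
    proof
      assume "v \<in> B"
      then have "orthogonal v v" using v(1) by (simp add: V_def)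
      then show False using v(2) by (simp add: orthogonal_def)
    qed
    moreover have "P (insert v B)"
      using B v unfolding P_def V_def by (auto simp: pairwise_insert orthogonal_commute)
    ultimately show False using max[of "insert v B"] fin[OF B] by simp
  qed
  moreover obtain l where "\<And>b. b \<in> B \<Longrightarrow> f b = l b *\<^sub>R b"
    using B unfolding P_def by metis
  ultimately show ?thesis using that[of B l] fin[OF B] B by (auto simp: P_def)
qed

section \<open>Matrix products, adjoints and Hermitian forms\<close>

lemma bounded_bilinear_matrix_mult:
  "bounded_bilinear ((**) :: complex^'m^'k \<Rightarrow> complex^'n^'m \<Rightarrow> complex^'n^'k)"
proof -
  have "bilinear ((**) :: complex^'m^'k \<Rightarrow> complex^'n^'m \<Rightarrow> complex^'n^'k)"
    by (auto simp: bilinear_def linear_iff matrix_add_ldistrib matrix_scalar_ac scalar_matrix_assoc)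
      (vector matrix_matrix_mult_def sum.distrib ring_distribs)
  then show ?thesis by (simp add: bilinear_conv_bounded_bilinear)
qed

text \<open>Bilinearity is taken over the reals. The interpretations \<open>mm\<close> and
  \<open>mv\<close> supply distributivity, limits and the product rule for all later matrix
  computations.\<close>

interpretation mm: bounded_bilinear "(**) :: complex^'m^'k \<Rightarrow> complex^'n^'m \<Rightarrow> complex^'n^'k"
  by (rule bounded_bilinear_matrix_mult)

lemma bounded_bilinear_matrix_vector_mult:
  "bounded_bilinear ((*v) :: complex^'m^'k \<Rightarrow> complex^'m \<Rightarrow> complex^'k)"
proof -
  have "linear (\<lambda>A::complex^'m^'k. A *v x)" for x
    by (auto simp: linear_iff matrix_vector_mult_add_rdistrib)
       (vector matrix_vector_mult_def scaleR_sum_right)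
  then have "bilinear ((*v) :: complex^'m^'k \<Rightarrow> complex^'m \<Rightarrow> complex^'k)"
    by (simp add: bilinear_def)
  then show ?thesis by (simp add: bilinear_conv_bounded_bilinear)
qed

interpretation mv: bounded_bilinear "(*v) :: complex^'m^'k \<Rightarrow> complex^'m \<Rightarrow> complex^'k"
  by (rule bounded_bilinear_matrix_vector_mult)

lemma conj_transpose_mult: "conj_transpose (A ** B) = conj_transpose B ** conj_transpose A"
  by (simp add: conj_transpose_def matrix_matrix_mult_def vec_eq_iff mult.commute)

lemma conj_transpose_conj_transpose [simp]: "conj_transpose (conj_transpose A) = A"
  by (simp add: conj_transpose_def vec_eq_iff)

lemma conj_transpose_mat_1 [simp]: "conj_transpose (mat 1) = mat 1"
  by (simp add: conj_transpose_def vec_eq_iff mat_def)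

lemma linear_conj_transpose: "linear conj_transpose"
  by (auto simp: linear_iff conj_transpose_def vec_eq_iff)

lemmas conj_transpose_add = linear_add[OF linear_conj_transpose]
  and conj_transpose_diff = linear_diff[OF linear_conj_transpose]
  and conj_transpose_scaleR = linear_cmul[OF linear_conj_transpose]
  and conj_transpose_sum = linear_sum[OF linear_conj_transpose]

lemma inner_complex_vector: "x \<bullet> y = Re (\<Sum>i\<in>UNIV. cnj (x $ i) * y $ i)" for x y :: "complex^'n"
  by (simp add: inner_vec_def inner_complex_def)

lemma pos_def_mat_iff: "pos_def_mat A \<longleftrightarrow> hermitian_mat A \<and> (\<forall>x. x \<noteq> 0 \<longrightarrow> 0 < x \<bullet> (A *v x))"
  by (simp add: pos_def_mat_def inner_complex_vector)

lemma inner_conj_transpose: "x \<bullet> (A *v y) = (conj_transpose A *v x) \<bullet> y"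
  for x y :: "complex^'n"
proof -
  have "(\<Sum>i\<in>UNIV. cnj (x $ i) * (A *v y) $ i) = (\<Sum>j\<in>UNIV. cnj ((conj_transpose A *v x) $ j) * y $ j)"
    unfolding matrix_vector_mult_def conj_transpose_def
    by (simp add: sum_distrib_left sum_distrib_right) (subst sum.swap, simp add: mult_ac)
  then show ?thesis by (simp add: inner_complex_vector)
qed

lemma hermitian_mat_inner: "hermitian_mat A \<Longrightarrow> x \<bullet> (A *v y) = (A *v x) \<bullet> y"
  by (simp add: inner_conj_transpose hermitian_mat_def)

lemma hermitian_mat_add: "hermitian_mat A \<Longrightarrow> hermitian_mat B \<Longrightarrow> hermitian_mat (A + B)"
  and hermitian_mat_diff: "hermitian_mat A \<Longrightarrow> hermitian_mat B \<Longrightarrow> hermitian_mat (A - B)"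
  and hermitian_mat_scaleR: "hermitian_mat A \<Longrightarrow> hermitian_mat (c *\<^sub>R A)"
  by (simp_all add: hermitian_mat_def conj_transpose_add conj_transpose_diff conj_transpose_scaleR)

lemma conj_transpose_eqI:
  fixes A B :: "complex^'n^'n"
  assumes "\<And>x y. x \<bullet> (A *v y) = (B *v x) \<bullet> y"
  shows "conj_transpose A = B"
proof -
  have "conj_transpose A *v x = B *v x" for x
    using assms[of x] vector_eq_rdot by (metis inner_conj_transpose)
  then show ?thesis by (simp add: matrix_eq)
qed

text \<open>The span is over the reals, so matrix identities can be tested on the real eigenbasis of
  \<open>self_adjoint_eigenbasis\<close>.\<close>

lemma matrix_eq_on_span:
  fixes A B :: "complex^'n^'n"
  assumes "span W = UNIV" "\<And>w. w \<in> W \<Longrightarrow> A *v w = B *v w"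
  shows "A = B"
proof -
  have "A *v x = B *v x" for x
    using linear_eq_on_span[of "(*v) A" "(*v) B" W x] assms by simp
  then show ?thesis by (simp add: matrix_eq)
qed

text \<open>The idempotents need not be Hermitian: conjugating by an invertible matrix must stay
  inside the notion, because the square root of \<open>A\<^sup>-\<^sup>1 B\<close> is only similar
  to a Hermitian matrix. Where orthogonal projections matter, \<open>hermitian_mat (E l)\<close> is
  a separate hypothesis.\<close>

definition spectral_resolution :: "real set \<Rightarrow> (real \<Rightarrow> complex^'n^'n) \<Rightarrow> bool" where
  "spectral_resolution L E \<longleftrightarrow> finite L \<and> (\<Sum>l\<in>L. E l) = mat 1 \<and>
     (\<forall>l\<in>L. \<forall>m\<in>L. E l ** E m = (if l = m then E l else 0))"

definition fcalc :: "real set \<Rightarrow> (real \<Rightarrow> complex^'n^'n) \<Rightarrow> (real \<Rightarrow> real) \<Rightarrow> complex^'n^'n" where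
  "fcalc L E f = (\<Sum>l\<in>L. f l *\<^sub>R E l)"

lemma linear_scale_i: "linear (\<lambda>x::complex^'n. \<i> *s x)"
  by (auto simp: linear_iff vec_eq_iff algebra_simps)

lemma vector_scale_i:
  fixes x :: "complex^'n"
  shows "c *s x = Re c *\<^sub>R x + Im c *\<^sub>R (\<i> *s x)"
proof -
  have "c * x $ i = Re c *\<^sub>R x $ i + Im c *\<^sub>R (\<i> * x $ i)" for i
    by (simp add: complex_eq_iff)
  then show ?thesis by (simp add: vec_eq_iff)
qed

lemma matrix_works_real_linear:
  fixes p :: "complex^'n \<Rightarrow> complex^'n"
  assumes "linear p" "\<And>x. p (\<i> *s x) = \<i> *s p x"
  shows "matrix p *v x = p x"
proof (rule matrix_works)
  interpret p: linear p by fact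
  have "p (c *s x) = c *s p x" for c x
    by (subst (1 2) vector_scale_i) (simp add: p.add p.scale assms(2))
  then show "Vector_Spaces.linear (*s) (*s) p"
    by (intro Vector_Spaces.linear_iff[THEN iffD2])
      (simp add: p.add vec.vector_space_axioms)
qed

theorem spectral_theorem:
  fixes P :: "complex^'n^'n"
  assumes "hermitian_mat P"
  obtains L E where "spectral_resolution L E" "P = fcalc L E (\<lambda>l. l)"
    "\<And>l. l \<in> L \<Longrightarrow> hermitian_mat (E l)"
    "\<And>l. l \<in> L \<Longrightarrow> \<exists>v. v \<noteq> 0 \<and> P *v v = l *\<^sub>R v"
proof -
  obtain B l where B: "finite B" "pairwise orthogonal B" "\<And>b. b \<in> B \<Longrightarrow> norm b = 1"
    and spanB: "span B = UNIV" and eig: "\<And>b. b \<in> B \<Longrightarrow> P *v b = l b *\<^sub>R b"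
    by (rule self_adjoint_eigenbasis[OF matrix_vector_mul_linear hermitian_mat_inner[OF assms]]) (rule that)
  \<comment> \<open>For each eigenvalue m, this is the orthogonal projection onto the real span of
    the basis vectors belonging to m.\<close>
  define p where "p m x = (\<Sum>b\<in>{b\<in>B. l b = m}. (x \<bullet> b) *\<^sub>R b)" for m x
  define W where "W = {x. \<exists>m. P *v x = m *\<^sub>R x}"
  have "B \<subseteq> W" using eig by (auto simp: W_def)
  then have spanW: "span W = UNIV" using spanB span_mono by blast
  have lin: "linear (p m)" for m
    unfolding p_def
    by (auto simp: linear_iff inner_add_left scaleR_add_left sum.distrib scaleR_sum_right)
  have expand: "(\<Sum>b\<in>B. (x \<bullet> b) *\<^sub>R b) = x" for x
    using orthonormal_basis_expand[of B x] B spanB by auto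
  \<comment> \<open>Formulated for arbitrary eigenvectors and not just members of B, because it is
    also applied to \<open>\<i> *s x\<close>, which need not lie in B.\<close>
  have p_eig: "p m x = (if k = m then x else 0)" if "P *v x = k *\<^sub>R x" for m k x
  proof -
    have orth: "x \<bullet> b = 0" if "b \<in> B" "l b \<noteq> k" for b
    proof -
      have "k * (x \<bullet> b) = l b * (x \<bullet> b)"
        using hermitian_mat_inner[OF assms, of x b] eig \<open>P *v x = _\<close> that by simp
      then show ?thesis using that by simp
    qed
    show ?thesis
    proof (cases "k = m")
      case True
      have "p m x = (\<Sum>b\<in>B. (x \<bullet> b) *\<^sub>R b)"
        unfolding p_def using B orth True by (intro sum.mono_neutral_left) auto
      then show ?thesis using expand True by simp
    next
      case False
      then show ?thesis using orth by (auto simp: p_def)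
    qed
  qed
  have iP: "P *v (\<i> *s x) = \<i> *s (P *v x)" for x
    by (simp add: vector_smult_lneg matrix_vector_mult_def vec_eq_iff sum_distrib_left mult_ac)
  \<comment> \<open>So far \<open>complex^'n\<close> was a real inner product space. Commuting with \<open>\<i>\<close> makes the
    projections complex linear, hence matrices; it suffices to check it on eigenvectors.\<close>
  have p_i: "p m (\<i> *s x) = \<i> *s p m x" for m x
  proof -
    have "linear (\<lambda>x. p m (\<i> *s x))" "linear (\<lambda>x. \<i> *s p m x)"
      using linear_compose[OF linear_scale_i lin] linear_compose[OF lin linear_scale_i]
      by (simp_all add: o_def)
    moreover have "p m (\<i> *s w) = \<i> *s p m w" if "w \<in> W" for w
    proof -
      obtain k where k: "P *v w = k *\<^sub>R w" using \<open>w \<in> W\<close> by (auto simp: W_def)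
      then have "P *v (\<i> *s w) = k *\<^sub>R (\<i> *s w)"
        unfolding iP by (simp add: vec_eq_iff)
      from p_eig[OF this] show ?thesis using p_eig[OF k] by simp
    qed
    ultimately show ?thesis
      using linear_eq_on_span[of "\<lambda>x. p m (\<i> *s x)" "\<lambda>x. \<i> *s p m x" W x] spanW by simp
  qed
  define E where "E m = matrix (p m)" for m
  have E: "E m *v x = p m x" for m x
    unfolding E_def by (rule matrix_works_real_linear[OF lin p_i])
  define L where "L = l ` B"
  have finL: "finite L" using B by (simp add: L_def)
  have E_b: "E m *v b = (if l b = m then b else 0)" if "b \<in> B" for m b
    using E p_eig[OF eig[OF that]] by simp
  have "spectral_resolution L E"
    unfolding spectral_resolution_def
  proof (intro conjI ballI finL)
    show "(\<Sum>l\<in>L. E l) = mat 1"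
      by (rule matrix_eq_on_span[OF spanB])
        (use finL in \<open>auto simp: mv.sum_left E_b L_def\<close>)
    show "E k ** E m = (if k = m then E k else 0)" for k m
      by (rule matrix_eq_on_span[OF spanB]) (simp add: E_b flip: matrix_vector_mul_assoc)
  qed
  moreover have "P = fcalc L E (\<lambda>l. l)"
    by (rule matrix_eq_on_span[OF spanB])
      (use finL in \<open>auto simp: fcalc_def mv.sum_left mv.scaleR_left E_b eig L_def
        if_distrib[of "scaleR _"] cong: if_cong\<close>)
  moreover have "hermitian_mat (E m)" for m
    unfolding hermitian_mat_def
    by (rule conj_transpose_eqI)
      (simp add: E p_def inner_sum_left inner_sum_right inner_commute mult_ac)
  moreover have "\<exists>v. v \<noteq> 0 \<and> P *v v = k *\<^sub>R v" if "k \<in> L" for k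
  proof -
    obtain b where "b \<in> B" "k = l b" using \<open>k \<in> L\<close> by (auto simp: L_def)
    then show ?thesis using eig[of b] B(3)[of b] by (intro exI[of _ b]) auto
  qed
  ultimately show ?thesis using that by blast
qed

section \<open>Functional calculus and square roots\<close>

lemma spectral_resolutionD:
  assumes "spectral_resolution L E"
  shows "finite L" "(\<Sum>l\<in>L. E l) = mat 1"
    "\<And>l m. l \<in> L \<Longrightarrow> m \<in> L \<Longrightarrow> E l ** E m = (if l = m then E l else 0)"
  using assms by (auto simp: spectral_resolution_def)

lemma fcalc_cong: "(\<And>l. l \<in> L \<Longrightarrow> f l = g l) \<Longrightarrow> fcalc L E f = fcalc L E g"
  by (simp add: fcalc_def)

lemma fcalc_add: "fcalc L E f + fcalc L E g = fcalc L E (\<lambda>l. f l + g l)"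
  by (simp add: fcalc_def sum.distrib scaleR_add_left)

lemma fcalc_scaleR: "c *\<^sub>R fcalc L E f = fcalc L E (\<lambda>l. c * f l)"
  by (simp add: fcalc_def scaleR_sum_right)

lemma fcalc_1: "spectral_resolution L E \<Longrightarrow> fcalc L E (\<lambda>_. 1) = mat 1"
  by (simp add: fcalc_def spectral_resolution_def)

lemma fcalc_mult_projection:
  assumes "spectral_resolution L E" "l \<in> L"
  shows "fcalc L E f ** E l = f l *\<^sub>R E l" "E l ** fcalc L E f = f l *\<^sub>R E l"
  using assms spectral_resolutionD[OF assms(1)]
  by (simp_all add: fcalc_def mm.sum_left mm.sum_right mm.scaleR_left mm.scaleR_right
      if_distrib[of "scaleR _"] cong: if_cong)

lemma fcalc_mult:
  assumes "spectral_resolution L E"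
  shows "fcalc L E f ** fcalc L E g = fcalc L E (\<lambda>l. f l * g l)"
proof -
  have "fcalc L E f ** fcalc L E g = (\<Sum>l\<in>L. g l *\<^sub>R (fcalc L E f ** E l))"
    by (simp add: fcalc_def[of L E g] mm.sum_right mm.scaleR_right)
  also have "\<dots> = fcalc L E (\<lambda>l. f l * g l)"
    by (simp add: fcalc_def[of L E "\<lambda>l. f l * g l"] fcalc_mult_projection[OF assms] mult.commute)
  finally show ?thesis .
qed

lemma spectral_resolution_similar:
  assumes "spectral_resolution L E" "V ** W = mat 1" "W ** V = mat 1"
  shows "spectral_resolution L (\<lambda>l. V ** E l ** W)"
    and "fcalc L (\<lambda>l. V ** E l ** W) f = V ** fcalc L E f ** W"
proof -
  note D = spectral_resolutionD[OF assms(1)]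
  have "(V ** E l ** W) ** (V ** E m ** W) = V ** (E l ** E m) ** W" for l m
    by (metis matrix_mul_assoc matrix_mul_rid assms(3))
  then show "spectral_resolution L (\<lambda>l. V ** E l ** W)"
    using D assms(2) by (auto simp: spectral_resolution_def simp flip: mm.sum_left mm.sum_right)
  show "fcalc L (\<lambda>l. V ** E l ** W) f = V ** fcalc L E f ** W"
    by (simp add: fcalc_def mm.sum_left mm.sum_right mm.scaleR_left mm.scaleR_right)
qed

text \<open>Sandwiching the commutation relation between E m and E k gives f m and f k as factors of
  the same block of K; since f separates the points of L, the off-diagonal blocks vanish. A square
  root commutes with its square, so it inherits the block structure of the square.\<close>

lemma fcalc_commute:
  assumes res: "spectral_resolution L E" and inj: "inj_on f L"
    and com: "K ** fcalc L E f = fcalc L E f ** K" and l: "l \<in> L"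
  shows "K ** E l = E l ** K"
proof -
  note D = spectral_resolutionD[OF res] and M = fcalc_mult_projection[OF res]
  have zero: "E m ** K ** E k = 0" if "m \<in> L" "k \<in> L" "m \<noteq> k" for m k
  proof -
    have "f m *\<^sub>R (E m ** K ** E k) = (E m ** fcalc L E f) ** K ** E k"
      using M that by (simp add: mm.scaleR_left)
    also have "\<dots> = E m ** K ** (fcalc L E f ** E k)"
      by (metis com matrix_mul_assoc)
    also have "\<dots> = f k *\<^sub>R (E m ** K ** E k)"
      using M that by (simp add: mm.scaleR_right)
    finally show ?thesis using inj that by (auto dest: inj_onD)
  qed
  have "K ** E l = (\<Sum>m\<in>L. E m) ** K ** E l"
    using D by simp
  also have "\<dots> = (\<Sum>m\<in>L. if m = l then E l ** K ** E l else 0)"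
    unfolding mm.sum_left using zero l by (intro sum.cong) auto
  also have "\<dots> = (\<Sum>m\<in>L. E l ** K ** E m)"
    using zero l by (intro sum.cong) auto
  also have "\<dots> = E l ** K ** (\<Sum>m\<in>L. E m)"
    by (simp add: mm.sum_right)
  finally show ?thesis using D by simp
qed

lemma mat_power_fcalc:
  "spectral_resolution L E \<Longrightarrow> mat_power (fcalc L E f) k = fcalc L E (\<lambda>l. f l ^ k)"
  by (induction k) (simp_all add: fcalc_1 fcalc_mult)

text \<open>The matrix series splits into finitely many scalar exponential series, one for each
  idempotent.\<close>

lemma mat_exp_fcalc:
  assumes "spectral_resolution L E"
  shows "mat_exp (fcalc L E f) = fcalc L E (\<lambda>l. exp (f l))"
proof -
  have "(\<lambda>k. (f l ^ k /\<^sub>R fact k) *\<^sub>R E l) sums (exp (f l) *\<^sub>R E l)" for l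
    by (intro sums_scaleR_left exp_converges)
  then have "(\<lambda>k. \<Sum>l\<in>L. (f l ^ k /\<^sub>R fact k) *\<^sub>R E l) sums (\<Sum>l\<in>L. exp (f l) *\<^sub>R E l)"
    by (intro sums_sum)
  then show ?thesis
    unfolding mat_exp_def mat_power_fcalc[OF assms] fcalc_scaleR
    by (simp add: sums_iff fcalc_def divide_inverse mult.commute)
qed

lemma fcalc_eigenvalue_pos:
  assumes res: "spectral_resolution L E" and pos: "\<And>l. l \<in> L \<Longrightarrow> 0 < l"
    and ev: "eigenvalue_mat (fcalc L E (\<lambda>l. l)) c"
  shows "\<exists>r>0. c = of_real r"
proof -
  note D = spectral_resolutionD[OF res]
  obtain v where v: "v \<noteq> 0" "fcalc L E (\<lambda>l. l) *v v = c *s v"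
    using ev by (auto simp: eigenvalue_mat_def)
  have "(\<Sum>l\<in>L. E l *v v) = v"
    using D(2) by (metis mv.sum_left matrix_vector_mul_lid)
  then obtain l where l: "l \<in> L" "E l *v v \<noteq> 0"
    using v(1) by (metis sum.neutral)
  have "l *\<^sub>R (E l *v v) = E l *v (fcalc L E (\<lambda>l. l) *v v)"
    using fcalc_mult_projection[OF res l(1)] by (simp add: matrix_vector_mul_assoc mv.scaleR_left)
  also have "\<dots> = c *s (E l *v v)"
    by (simp add: v vec.scale)
  finally have "of_real l * (E l *v v) $ i = c * (E l *v v) $ i" for i
    by (metis vector_scaleR_component vector_smult_component scaleR_conv_of_real)
  moreover obtain i where "(E l *v v) $ i \<noteq> 0" using l(2) by (auto simp: vec_eq_iff)
  ultimately have "c = of_real l" by (metis mult_right_cancel)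
  then show ?thesis using pos l(1) by blast
qed

text \<open>The last hypothesis, that T has no negative real eigenvalue, follows both from positive
  definiteness and from positivity of all eigenvalues. One uniqueness proof thus determines both
  \<open>pd_sqrt\<close> and \<open>pos_eig_sqrt\<close>, with no diagonalizability assumed of
  T.\<close>

lemma fcalc_square_root_unique:
  assumes res: "spectral_resolution L E" and pos: "\<And>l. l \<in> L \<Longrightarrow> 0 < l"
    and sq: "T ** T = fcalc L E (\<lambda>l. l) ** fcalc L E (\<lambda>l. l)"
    and T: "\<And>r v. 0 < r \<Longrightarrow> T *v v = - r *\<^sub>R v \<Longrightarrow> v = 0"
  shows "T = fcalc L E (\<lambda>l. l)"
proof -
  note D = spectral_resolutionD[OF res]
  have sq': "T ** T = fcalc L E (\<lambda>l. l * l)"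
    using sq by (simp add: fcalc_mult[OF res])
  have inj: "inj_on (\<lambda>l. l * l) L"
  proof (rule inj_onI)
    fix l m assume "l \<in> L" "m \<in> L" "l * l = m * m"
    then show "l = m" using pos[of l] pos[of m] by (auto simp: square_eq_iff)
  qed
  have com: "T ** E l = E l ** T" if "l \<in> L" for l
    using fcalc_commute[OF res inj _ that, of T] by (metis sq' matrix_mul_assoc)
  \<comment> \<open>On the range of \<open>E l\<close> we have \<open>(T + l) (T - l) = 0\<close>, and \<open>T + l\<close> is injective.\<close>
  have "T ** E l = l *\<^sub>R E l" if l: "l \<in> L" for l
  proof -
    have TTE: "T ** (T ** E l) = (l * l) *\<^sub>R E l"
      using fcalc_mult_projection[OF res l] by (simp add: matrix_mul_assoc sq')
    have "(T ** E l) *v x = (l *\<^sub>R E l) *v x" for x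
    proof -
      define y where "y = (T ** E l) *v x - (l *\<^sub>R E l) *v x"
      have "T *v y = - l *\<^sub>R y"
        using arg_cong[OF TTE, of "\<lambda>A. A *v x"]
        by (simp add: y_def mv.diff_right matrix_vector_mul_assoc mm.scaleR_right mv.scaleR_left
            mv.scaleR_right algebra_simps)
      then show ?thesis using T[of l y] pos[OF l] by (simp add: y_def)
    qed
    then show ?thesis by (simp add: matrix_eq)
  qed
  then have "T ** (\<Sum>l\<in>L. E l) = fcalc L E (\<lambda>l. l)"
    by (simp add: mm.sum_right fcalc_def)
  then show ?thesis using D by simp
qed

lemma pos_eig_sqrt_fcalc:
  assumes res: "spectral_resolution L E" and pos: "\<And>l. l \<in> L \<Longrightarrow> 0 < l"
  shows "pos_eig_sqrt (fcalc L E (\<lambda>l. l) ** fcalc L E (\<lambda>l. l)) = fcalc L E (\<lambda>l. l)"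
  unfolding pos_eig_sqrt_def
proof (rule the_equality, intro conjI allI impI refl)
  fix c assume "eigenvalue_mat (fcalc L E (\<lambda>l. l)) c"
  then show "\<exists>r>0. c = of_real r"
    using fcalc_eigenvalue_pos[OF res pos] by blast
next
  fix T assume T: "T ** T = fcalc L E (\<lambda>l. l) ** fcalc L E (\<lambda>l. l) \<and>
    (\<forall>c. eigenvalue_mat T c \<longrightarrow> (\<exists>r>0. c = of_real r))"
  show "T = fcalc L E (\<lambda>l. l)"
  proof (rule fcalc_square_root_unique[OF res pos])
    fix r :: real and v assume r: "0 < r" and v: "T *v v = - r *\<^sub>R v"
    show "v = 0"
    proof (rule ccontr)
      assume "v \<noteq> 0"
      moreover have "T *v v = of_real (- r) *s v"
        unfolding v by (simp add: vec_eq_iff) (simp add: scaleR_conv_of_real)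
      ultimately have "eigenvalue_mat T (of_real (- r))"
        unfolding eigenvalue_mat_def by blast
      then obtain s :: real where "s > 0" "complex_of_real (- r) = of_real s" using T by blast
      then show False using r by (metis of_real_eq_iff neg_0_less_iff_less order_less_asym)
    qed
  qed (use T in auto)
qed

section \<open>Hermitian functional calculus and positive definite roots\<close>

lemma hermitian_mat_fcalc:
  "(\<And>l. l \<in> L \<Longrightarrow> hermitian_mat (E l)) \<Longrightarrow> hermitian_mat (fcalc L E f)"
  by (simp add: hermitian_mat_def fcalc_def conj_transpose_sum conj_transpose_scaleR)

text \<open>A Hermitian idempotent is an orthogonal projection, so its quadratic form is the squared
  length of the component. Positivity and lower bounds are then read off from the values of
  f.\<close>

lemma fcalc_quadratic_form:
  assumes res: "spectral_resolution L E" and herm: "\<And>l. l \<in> L \<Longrightarrow> hermitian_mat (E l)"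
  shows "x \<bullet> (fcalc L E f *v x) = (\<Sum>l\<in>L. f l * (norm (E l *v x))\<^sup>2)"
proof -
  have "x \<bullet> (E l *v x) = (norm (E l *v x))\<^sup>2" if "l \<in> L" for l
    using hermitian_mat_inner[OF herm[OF that], of x "E l *v x"] spectral_resolutionD(3)[OF res that that]
    by (simp add: matrix_vector_mul_assoc power2_norm_eq_inner)
  then show ?thesis
    by (simp add: fcalc_def mv.sum_left mv.scaleR_left inner_sum_right)
qed

lemma pos_def_mat_fcalc:
  assumes res: "spectral_resolution L E" and herm: "\<And>l. l \<in> L \<Longrightarrow> hermitian_mat (E l)"
    and pos: "\<And>l. l \<in> L \<Longrightarrow> 0 < f l"
  shows "pos_def_mat (fcalc L E f)"
  unfolding pos_def_mat_iff
proof (intro conjI allI impI)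
  show "hermitian_mat (fcalc L E f)" using herm by (rule hermitian_mat_fcalc)
  fix x :: "complex^'a" assume "x \<noteq> 0"
  note D = spectral_resolutionD[OF res]
  have "(\<Sum>l\<in>L. E l *v x) = x"
    using D(2) by (metis mv.sum_left matrix_vector_mul_lid)
  then obtain l where l: "l \<in> L" "E l *v x \<noteq> 0"
    using \<open>x \<noteq> 0\<close> by (metis sum.neutral)
  have "0 < (\<Sum>l\<in>L. f l * (norm (E l *v x))\<^sup>2)"
  proof (rule sum_pos2[of L l])
    show "0 < f l * (norm (E l *v x))\<^sup>2" using l pos by simp
    show "0 \<le> f m * (norm (E m *v x))\<^sup>2" if "m \<in> L" for m
      using pos[OF that] by simp
  qed (use D l in auto)
  then show "0 < x \<bullet> (fcalc L E f *v x)"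
    using fcalc_quadratic_form[OF res herm] by simp
qed

lemma pos_def_spectral:
  fixes P :: "complex^'n^'n"
  assumes "pos_def_mat P"
  obtains L E where "spectral_resolution L E" "P = fcalc L E (\<lambda>l. l)"
    "\<And>l. l \<in> L \<Longrightarrow> hermitian_mat (E l)" "\<And>l. l \<in> L \<Longrightarrow> 0 < l"
proof -
  obtain L E where *: "spectral_resolution L E" "P = fcalc L E (\<lambda>l. l)"
    "\<And>l. l \<in> L \<Longrightarrow> hermitian_mat (E l)" "\<And>l. l \<in> L \<Longrightarrow> \<exists>v. v \<noteq> 0 \<and> P *v v = l *\<^sub>R v"
    using spectral_theorem assms unfolding pos_def_mat_iff by blast
  have "0 < l" if "l \<in> L" for l
  proof -
    obtain v where "v \<noteq> 0" "P *v v = l *\<^sub>R v" using *(4)[OF \<open>l \<in> L\<close>] by blast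
    then show ?thesis using assms unfolding pos_def_mat_iff
      by (metis inner_ge_zero inner_scaleR_right zero_less_mult_pos2 inner_gt_zero_iff)
  qed
  then show ?thesis using that * by blast
qed

lemma pos_def_no_negative_eigenvalue:
  assumes "pos_def_mat T" "0 < r" "T *v v = - r *\<^sub>R v"
  shows "v = 0"
proof (rule ccontr)
  assume "v \<noteq> 0"
  then have "0 < - r * (v \<bullet> v)" using assms unfolding pos_def_mat_iff by fastforce
  moreover have "0 < r * (v \<bullet> v)" using \<open>v \<noteq> 0\<close> assms(2) by simp
  ultimately show False by simp
qed

lemma pd_sqrt_square:
  assumes "pos_def_mat S"
  shows "pd_sqrt (S ** S) = S"
proof -
  obtain L E where *: "spectral_resolution L E" "S = fcalc L E (\<lambda>l. l)"
    "\<And>l. l \<in> L \<Longrightarrow> 0 < l"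
    using pos_def_spectral[OF assms] by metis
  show ?thesis
    unfolding pd_sqrt_def
    by (rule the_equality)
      (use assms fcalc_square_root_unique[OF *(1,3)] pos_def_no_negative_eigenvalue in \<open>auto simp: *(2)\<close>)
qed

lemma pos_def_pd_sqrt:
  assumes "pos_def_mat P"
  shows "pos_def_mat (pd_sqrt P)" "pd_sqrt P ** pd_sqrt P = P"
proof -
  obtain L E where *: "spectral_resolution L E" "P = fcalc L E (\<lambda>l. l)"
    "\<And>l. l \<in> L \<Longrightarrow> hermitian_mat (E l)" "\<And>l. l \<in> L \<Longrightarrow> 0 < l"
    using pos_def_spectral[OF assms] by metis
  define S where "S = fcalc L E sqrt"
  have S: "pos_def_mat S" unfolding S_def using * by (intro pos_def_mat_fcalc) auto
  have SS: "S ** S = P"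
    unfolding S_def fcalc_mult[OF *(1)] *(2)
    by (rule fcalc_cong) (use *(4) in \<open>force simp: less_imp_le\<close>)
  then have "pd_sqrt P = S" using pd_sqrt_square[OF S] by simp
  then show "pos_def_mat (pd_sqrt P)" "pd_sqrt P ** pd_sqrt P = P" using S SS by auto
qed

section \<open>Inverses and congruence\<close>

lemma matrix_inv_inverse:
  fixes A :: "complex^'n^'n"
  assumes "invertible A"
  shows "A ** matrix_inv A = mat 1" "matrix_inv A ** A = mat 1"
  using someI_ex[OF assms[unfolded invertible_def]] by (auto simp: matrix_inv_def)

lemma matrix_inv_eqI:
  fixes A :: "complex^'n^'n"
  assumes "A ** B = mat 1"
  shows "matrix_inv A = B"
proof -
  have "invertible A" using assms invertible_right_inverse by blast
  then show ?thesis
    by (metis matrix_inv_inverse(2) matrix_mul_assoc matrix_mul_lid matrix_mul_rid assms)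
qed

lemma pos_def_invertible:
  assumes "pos_def_mat A"
  shows "invertible A"
proof -
  have "x = 0" if "A *v x = 0" for x
    using assms that unfolding pos_def_mat_iff by fastforce
  then show ?thesis
    unfolding invertible_left_inverse matrix_left_invertible_ker by blast
qed

lemma pos_def_congruence:
  assumes "pos_def_mat P" "invertible W"
  shows "pos_def_mat (conj_transpose W ** P ** W)"
  unfolding pos_def_mat_iff
proof (intro conjI allI impI)
  show "hermitian_mat (conj_transpose W ** P ** W)"
    using assms by (simp add: pos_def_mat_iff hermitian_mat_def conj_transpose_mult matrix_mul_assoc)
  fix x :: "complex^'a" assume "x \<noteq> 0"
  then have "W *v x \<noteq> 0"
    using inj_matrix_vector_mult[OF assms(2)] by (metis injD matrix_vector_mult_0_right)
  then have "0 < (W *v x) \<bullet> (P *v (W *v x))" using assms by (simp add: pos_def_mat_iff)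
  then show "0 < x \<bullet> ((conj_transpose W ** P ** W) *v x)"
    by (simp add: inner_conj_transpose[of x "conj_transpose W"] flip: matrix_vector_mul_assoc)
qed

lemma hermitian_mat_inv:
  fixes A :: "complex^'n^'n"
  assumes "hermitian_mat A" "invertible A"
  shows "hermitian_mat (matrix_inv A)"
  using matrix_inv_inverse[OF assms(2)] assms(1) matrix_inv_eqI[of A "conj_transpose (matrix_inv A)"]
  by (metis conj_transpose_mat_1 conj_transpose_mult hermitian_mat_def)

lemma invertible_matrix_inv:
  fixes A :: "complex^'n^'n"
  shows "invertible A \<Longrightarrow> invertible (matrix_inv A)"
  using matrix_inv_inverse invertible_right_inverse by blast

section \<open>The operator norm and unitarily invariant norms\<close>

lemma norm_matrix_vector_le_op_norm: "norm (A *v x) \<le> op_norm A * norm x"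
  unfolding op_norm_def by (rule onorm) simp

lemma op_norm_le: "(\<And>x. norm (A *v x) \<le> c * norm x) \<Longrightarrow> op_norm A \<le> c"
  unfolding op_norm_def by (rule onorm_le)

lemma op_norm_nonneg [simp]: "0 \<le> op_norm A"
  unfolding op_norm_def by (rule onorm_pos_le) simp

lemma op_norm_add: "op_norm (A + B) \<le> op_norm A + op_norm B"
  unfolding op_norm_def mv.add_left by (rule onorm_triangle) simp_all

lemma op_norm_scaleR: "op_norm (c *\<^sub>R A) = \<bar>c\<bar> * op_norm A"
  unfolding op_norm_def mv.scaleR_left by (rule onorm_scaleR) simp

lemma op_norm_sum: "finite I \<Longrightarrow> op_norm (\<Sum>i\<in>I. A i) \<le> (\<Sum>i\<in>I. op_norm (A i))"
proof (induction I rule: finite_induct)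
  case empty
  then show ?case by (simp add: op_norm_def mv.zero_left[abs_def] onorm_zero)
next
  case (insert i I)
  then show ?case using op_norm_add[of "A i" "\<Sum>i\<in>I. A i"] by simp
qed

lemma op_norm_le_norm: "\<exists>K>0. \<forall>A::complex^'n^'n. op_norm A \<le> norm A * K"
proof -
  obtain K where K: "K > 0" "\<And>(A::complex^'n^'n) x. norm (A *v x) \<le> norm A * norm x * K"
    using mv.pos_bounded by blast
  have "op_norm A \<le> norm A * K" for A :: "complex^'n^'n"
    by (rule op_norm_le) (use K(2)[of A] in \<open>simp add: mult_ac\<close>)
  then show ?thesis using K by blast
qed

lemma op_norm_conj_transpose_le: "op_norm (conj_transpose A) \<le> op_norm A"
proof (rule op_norm_le)
  fix x
  let ?y = "conj_transpose A *v x"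
  have "(norm ?y)\<^sup>2 = x \<bullet> (A *v ?y)"
    by (simp add: inner_conj_transpose power2_norm_eq_inner)
  also have "\<dots> \<le> norm x * norm (A *v ?y)" by (rule norm_cauchy_schwarz)
  also have "\<dots> \<le> norm x * (op_norm A * norm ?y)"
    by (intro mult_left_mono norm_matrix_vector_le_op_norm) simp
  finally have "norm ?y * norm ?y \<le> (op_norm A * norm x) * norm ?y"
    by (simp add: power2_eq_square mult_ac)
  then show "norm ?y \<le> op_norm A * norm x"
    by (cases "norm ?y = 0") (simp_all add: mult_le_cancel_right)
qed

lemma op_norm_conj_transpose [simp]: "op_norm (conj_transpose A) = op_norm A"
  using op_norm_conj_transpose_le[of A] op_norm_conj_transpose_le[of "conj_transpose A"] by simp

lemma conj_transpose_invertible: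
  assumes "invertible A"
  shows "invertible (conj_transpose A)"
  using matrix_inv_inverse[OF assms] unfolding invertible_right_inverse
  by (metis conj_transpose_mat_1 conj_transpose_mult)

section \<open>Contractions as means of unitaries\<close>

lemma mat_mult_left: "mat c ** A = (\<chi> i j. c * (A :: complex^'n^'m) $ i $ j)"
  unfolding matrix_matrix_mult_def mat_def
  by (auto simp: if_distrib if_distribR sum.delta'[OF finite] cong: if_cong)

lemma mat_mult_right: "A ** mat c = (\<chi> i j. (A :: complex^'n^'m) $ i $ j * c)"
  unfolding matrix_matrix_mult_def mat_def
  by (auto simp: if_distrib if_distribR sum.delta'[OF finite] cong: if_cong)

lemma mat_i_commute: "mat \<i> ** A = A ** (mat \<i> :: complex^'n^'n)"
  by (simp add: mat_mult_left mat_mult_right mult.commute)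

lemma mat_i_square: "mat \<i> ** mat \<i> = - (mat 1 :: complex^'n^'n)"
  unfolding mat_mult_left by (simp add: mat_def vec_eq_iff)

lemma mat_i_mult_mat_i_mult: "(mat \<i> ** X) ** (mat \<i> ** Y) = - (X ** (Y :: complex^'n^'n))"
proof -
  have "(mat \<i> ** X) ** (mat \<i> ** Y) = (X ** (mat \<i> ** mat \<i>)) ** Y"
    unfolding mat_i_commute[of X] by (simp only: matrix_mul_assoc)
  then show ?thesis by (simp add: mat_i_square mm.minus_left mm.minus_right)
qed

lemma conj_transpose_mat_i: "conj_transpose (mat \<i>) = - mat \<i>"
  by (simp add: conj_transpose_def mat_def vec_eq_iff)

lemma conj_transpose_uminus: "conj_transpose (- A) = - conj_transpose A"
  using conj_transpose_scaleR[of "-1" A] by simp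

text \<open>With \<open>H = Z\<^sup>* Z = \<Sum> l E\<^sub>l\<close> and \<open>K = \<Sum> \<surd>((1 - l) / l) E\<^sub>l\<close> one has
  \<open>H + K H K = 1\<close>, so the unitaries are \<open>Z \<plusminus> i Z K\<close>.\<close>

lemma contraction_mean_of_unitaries:
  fixes Z :: "complex^'n^'n"
  assumes inv: "invertible Z" and le: "op_norm Z \<le> 1"
  obtains U V where "unitary_mat U" "unitary_mat V" "Z = (1/2) *\<^sub>R (U + V)"
proof -
  define H where "H = conj_transpose Z ** Z"
  have "pos_def_mat (mat 1 :: complex^'n^'n)"
    by (simp add: pos_def_mat_iff hermitian_mat_def)
  from pos_def_congruence[OF this inv] have "pos_def_mat H" by (simp add: H_def)
  then have "hermitian_mat H" by (simp add: pos_def_mat_iff)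
  then obtain L E where res: "spectral_resolution L E" and HE: "H = fcalc L E (\<lambda>l. l)"
    and herm: "\<And>l. l \<in> L \<Longrightarrow> hermitian_mat (E l)"
    and ev: "\<And>l. l \<in> L \<Longrightarrow> \<exists>v. v \<noteq> 0 \<and> H *v v = l *\<^sub>R v"
    using spectral_theorem by blast
  \<comment> \<open>These bounds make K meaningful: invertibility of Z keeps the denominator l
    positive, and the contraction property keeps \<open>1 - l\<close> nonnegative.\<close>
  have L: "0 < l \<and> l \<le> 1" if "l \<in> L" for l
  proof -
    obtain v where v: "v \<noteq> 0" "H *v v = l *\<^sub>R v" using ev[OF \<open>l \<in> L\<close>] by blast
    have "l * (v \<bullet> v) > 0"
      using \<open>pos_def_mat H\<close> v unfolding pos_def_mat_iff by fastforce
    moreover have "l * (v \<bullet> v) \<le> 1 * (v \<bullet> v)"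
    proof -
      have "l * (v \<bullet> v) = (norm (Z *v v))\<^sup>2"
        using arg_cong[OF v(2), of "\<lambda>y. v \<bullet> y"]
        by (simp add: H_def inner_conj_transpose[of v "conj_transpose Z"] power2_norm_eq_inner
            flip: matrix_vector_mul_assoc)
      also have "\<dots> \<le> (1 * norm v)\<^sup>2"
        by (intro power_mono order.trans[OF norm_matrix_vector_le_op_norm] mult_right_mono le) auto
      finally show ?thesis by (simp add: power2_norm_eq_inner)
    qed
    moreover have "v \<bullet> v > 0" using v by simp
    ultimately show ?thesis by (simp add: zero_less_mult_iff)
  qed
  define K where "K = fcalc L E (\<lambda>l. sqrt ((1 - l) / l))"
  have KH: "K ** H = H ** K" by (simp add: K_def HE fcalc_mult[OF res] mult.commute)
  have HKHK: "H + K ** H ** K = mat 1"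
    unfolding K_def HE fcalc_mult[OF res] fcalc_add fcalc_1[OF res, symmetric]
  proof (rule fcalc_cong)
    fix l assume "l \<in> L"
    then have l: "0 < l" "0 \<le> (1 - l) / l" using L[of l] by auto
    have "sqrt ((1 - l) / l) * l * sqrt ((1 - l) / l) = (sqrt ((1 - l) / l))\<^sup>2 * l"
      by (simp only: power2_eq_square mult_ac)
    also have "\<dots> = 1 - l" using l by simp
    finally show "l + sqrt ((1 - l) / l) * l * sqrt ((1 - l) / l) = 1" by simp
  qed
  have Kc: "conj_transpose K = K"
    using hermitian_mat_fcalc[of L E] herm by (simp add: hermitian_mat_def K_def)
  define Y where "Y = mat \<i> ** (Z ** K)"
  have Yc: "conj_transpose Y = - (mat \<i> ** (K ** conj_transpose Z))"
    unfolding mat_i_commute[of "K ** conj_transpose Z"]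
    by (simp add: Y_def conj_transpose_mult conj_transpose_mat_i Kc mm.minus_right)
  have ZY: "conj_transpose Z ** Y = mat \<i> ** (H ** K)"
    unfolding Y_def H_def matrix_mul_assoc mat_i_commute[of "conj_transpose Z"] ..
  have YZ: "conj_transpose Y ** Z = - (mat \<i> ** (H ** K))"
  proof -
    have "conj_transpose Y ** Z = - (mat \<i> ** (K ** H))"
      unfolding Yc mm.minus_left H_def matrix_mul_assoc ..
    then show ?thesis by (simp only: KH)
  qed
  have YY: "conj_transpose Y ** Y = K ** H ** K"
    unfolding Yc unfolding Y_def mm.minus_left mat_i_mult_mat_i_mult H_def
    by (simp add: matrix_mul_assoc)
  have unitary: "unitary_mat W" if "conj_transpose W ** W = mat 1" for W :: "complex^'n^'n"
    using that matrix_left_right_inverse unfolding unitary_mat_def by blast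
  \<comment> \<open>The cross terms \<open>ZY\<close> and \<open>YZ\<close> cancel, because K
    commutes with H and the adjoint of \<open>mat \<i>\<close> has the opposite sign. What remains
    is \<open>H + K ** H ** K\<close>, for either sign of Y.\<close>
  have "unitary_mat (Z + Y)"
    using HKHK by (intro unitary)
      (simp add: conj_transpose_add mm.add_left mm.add_right ZY YZ YY flip: H_def)
  moreover have "unitary_mat (Z - Y)"
    using HKHK by (intro unitary)
      (simp add: conj_transpose_diff mm.diff_left mm.diff_right ZY YZ YY flip: H_def)
  moreover have "Z = (1/2) *\<^sub>R ((Z + Y) + (Z - Y))"
    by (simp flip: scaleR_2)
  ultimately show ?thesis by (rule that)
qed

section \<open>Unitarily invariant norms under multiplication\<close>

lemma matrix_norm_props:
  assumes "matrix_norm N"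
  shows "0 \<le> N A" "N A = 0 \<longleftrightarrow> A = 0" "N (c *\<^sub>R A) = \<bar>c\<bar> * N A" "N (A + B) \<le> N A + N B"
    "N (A - B) = N (B - A)"
proof -
  have sc: "N (c *\<^sub>R A) = \<bar>c\<bar> * N A" for c A
  proof -
    have "c *\<^sub>R A = (\<chi> i j. complex_of_real c * A $ i $ j)"
      by (simp add: vec_eq_iff) (simp add: scaleR_conv_of_real)
    then show ?thesis using assms unfolding matrix_norm_def by (metis norm_of_real)
  qed
  then show "N (c *\<^sub>R A) = \<bar>c\<bar> * N A" .
  show "N (A - B) = N (B - A)" using sc[of "-1" "B - A"] by simp
qed (use assms in \<open>auto simp: matrix_norm_def\<close>)

text \<open>Expansion in the finite real basis gives the constant. This domination makes N
  continuous, which is what passing from Riemann sums to the integral requires.\<close>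

lemma matrix_norm_le_norm:
  fixes N :: "complex^'n^'n \<Rightarrow> real"
  assumes "matrix_norm N"
  shows "\<exists>C\<ge>0. \<forall>A. N A \<le> C * norm A"
proof -
  note P = matrix_norm_props[OF assms]
  have sum: "N (\<Sum>b\<in>I. f b) \<le> (\<Sum>b\<in>I. N (f b))" if "finite I" for I and f :: "complex^'n^'n \<Rightarrow> complex^'n^'n"
    using that
  proof (induction I rule: finite_induct)
    case empty
    then show ?case using P(2)[of 0] by simp
  next
    case (insert b I)
    then show ?case using P(4)[of "f b" "\<Sum>b\<in>I. f b"] by simp
  qed
  have "N A \<le> (\<Sum>b\<in>Basis. N b) * norm A" for A
  proof -
    have "N A = N (\<Sum>b\<in>Basis. (A \<bullet> b) *\<^sub>R b)" by (simp add: euclidean_representation)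
    also have "\<dots> \<le> (\<Sum>b\<in>Basis. \<bar>A \<bullet> b\<bar> * N b)"
      using sum[of Basis "\<lambda>b. (A \<bullet> b) *\<^sub>R b"] P(3) by simp
    also have "\<dots> \<le> (\<Sum>b\<in>Basis. norm A * N b)"
      by (intro sum_mono mult_right_mono Basis_le_norm P(1)) auto
    finally show ?thesis by (simp add: sum_distrib_left mult.commute)
  qed
  then show ?thesis using P(1) by (intro exI[of _ "\<Sum>b\<in>Basis. N b"]) (auto intro: sum_nonneg)
qed

lemma unitary_mat_1: "unitary_mat (mat 1)"
  by (simp add: unitary_mat_def)

lemma unitarily_invariant_norm_contraction:
  assumes N: "unitarily_invariant_norm N" and "invertible Z" "op_norm Z \<le> 1"
  shows "N (Z ** X) \<le> N X" "N (X ** Z) \<le> N X"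
proof -
  note P = matrix_norm_props[of N]
  have MN: "matrix_norm N" and inv: "\<And>U V A. unitary_mat U \<Longrightarrow> unitary_mat V \<Longrightarrow> N (U ** A ** V) = N A"
    using N by (auto simp: unitarily_invariant_norm_def)
  obtain U V where UV: "unitary_mat U" "unitary_mat V" "Z = (1/2) *\<^sub>R (U + V)"
    using contraction_mean_of_unitaries assms(2,3) by blast
  have "N (Z ** X) \<le> (N (U ** X) + N (V ** X)) / 2"
    using P(4)[OF MN, of "U ** X" "V ** X"] by (simp add: UV(3) mm.scaleR_left mm.add_left P(3)[OF MN])
  then show "N (Z ** X) \<le> N X"
    using inv[OF UV(1) unitary_mat_1, of X] inv[OF UV(2) unitary_mat_1, of X] by simp
  have "N (X ** Z) \<le> (N (X ** U) + N (X ** V)) / 2"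
    using P(4)[OF MN, of "X ** U" "X ** V"] by (simp add: UV(3) mm.scaleR_right mm.add_right P(3)[OF MN])
  then show "N (X ** Z) \<le> N X"
    using inv[OF unitary_mat_1 UV(1), of X] inv[OF unitary_mat_1 UV(2), of X] by simp
qed

lemma mat_1_neq_0: "(mat 1 :: complex^'n^'n) \<noteq> 0"
proof
  assume "(mat 1 :: complex^'n^'n) = 0"
  then have "(mat 1 :: complex^'n^'n) $ i $ i = 0" for i by simp
  then show False by (simp add: mat_def)
qed

lemma op_norm_invertible_pos:
  assumes "invertible Z"
  shows "0 < op_norm Z"
proof -
  have "Z \<noteq> 0" using matrix_inv_inverse(1)[OF assms] mat_1_neq_0 by force
  then obtain x where "Z *v x \<noteq> 0" by (auto simp: matrix_eq)
  then have "0 < op_norm Z * norm x"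
    using norm_matrix_vector_le_op_norm[of Z x] by (metis less_le_trans zero_less_norm_iff)
  then show ?thesis by (simp add: zero_less_mult_iff)
qed

lemma unitarily_invariant_norm_mult:
  assumes N: "unitarily_invariant_norm N" and Z: "invertible Z"
  shows "N (Z ** X) \<le> op_norm Z * N X" "N (X ** Z) \<le> op_norm Z * N X"
proof -
  have MN: "matrix_norm N" using N by (simp add: unitarily_invariant_norm_def)
  define c where "c = op_norm Z"
  have c: "c > 0" unfolding c_def using Z by (rule op_norm_invertible_pos)
  define W where "W = (1 / c) *\<^sub>R Z"
  have ZW: "Z = c *\<^sub>R W" using c by (simp add: W_def)
  have W: "invertible W" "op_norm W \<le> 1"
    using c Z by (auto simp: W_def scalar_invertible op_norm_scaleR c_def)
  note C = unitarily_invariant_norm_contraction[OF N W]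
  have "N (Z ** X) = c * N (W ** X)" "N (X ** Z) = c * N (X ** W)"
    using c by (simp_all add: ZW mm.scaleR_left mm.scaleR_right matrix_norm_props(3)[OF MN])
  then show "N (Z ** X) \<le> op_norm Z * N X" "N (X ** Z) \<le> op_norm Z * N X"
    using C c by (simp_all flip: c_def)
qed

lemma unitarily_invariant_norm_congruence:
  assumes N: "unitarily_invariant_norm N" and Z: "invertible Z"
  shows "N (conj_transpose Z ** X ** Z) \<le> (op_norm Z)\<^sup>2 * N X"
proof -
  have "N (conj_transpose Z ** X ** Z) \<le> op_norm Z * N (conj_transpose Z ** X)"
    by (rule unitarily_invariant_norm_mult[OF N Z])
  also have "\<dots> \<le> op_norm Z * (op_norm (conj_transpose Z) * N X)"
    by (intro mult_left_mono unitarily_invariant_norm_mult[OF N conj_transpose_invertible[OF Z]]) simp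
  finally show ?thesis by (simp add: power2_eq_square mult.assoc)
qed

section \<open>A norm bound for the Sylvester equation\<close>

text \<open>The triangle inequality for integrals, for an N that is not the norm of the type.
  Subadditivity gives it for Riemann sums over a common tagged division, and domination by
  \<open>norm\<close> carries it to the limit.\<close>

lemma seminorm_integral_bound:
  fixes f :: "real \<Rightarrow> 'a::real_normed_vector" and g :: "real \<Rightarrow> real" and N :: "'a \<Rightarrow> real"
  assumes add: "\<And>x y. N (x + y) \<le> N x + N y" and scale: "\<And>c x. N (c *\<^sub>R x) = \<bar>c\<bar> * N x"
    and bdd: "\<And>x. N x \<le> C * norm x" "0 \<le> C"
    and f: "(f has_integral y) (cbox a b)" and g: "(g has_integral z) (cbox a b)"
    and le: "\<And>x. x \<in> cbox a b \<Longrightarrow> N (f x) \<le> g x"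
  shows "N y \<le> z"
proof (rule field_le_epsilon)
  fix e :: real assume "e > 0"
  \<comment> \<open>The error budget: replacing the sum for f by y costs at most
    \<open>C * d\<close> in N, and replacing the sum for g by z costs d, together e.\<close>
  define d where "d = e / (C + 1)"
  have d: "d > 0" "C * d + d = e"
    using \<open>e > 0\<close> bdd(2) by (auto simp: d_def field_simps add_nonneg_eq_0_iff)
  have sum: "N (\<Sum>i\<in>I. h i) \<le> (\<Sum>i\<in>I. N (h i))" if "finite I" for I and h :: "real \<times> real set \<Rightarrow> 'a"
    using that
  proof (induction I rule: finite_induct)
    case empty
    then show ?case using scale[of 0 0] by simp
  next
    case (insert i I)
    then show ?case using add[of "h i" "\<Sum>i\<in>I. h i"] by simp
  qed
  obtain \<gamma>1 where g1: "gauge \<gamma>1" "\<forall>\<D>. \<D> tagged_division_of (cbox a b) \<and> \<gamma>1 fine \<D> \<longrightarrow>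
      norm ((\<Sum>(x, k)\<in>\<D>. measure lborel k *\<^sub>R f x) - y) < d"
    using f[unfolded has_integral, rule_format, OF d(1)] by blast
  obtain \<gamma>2 where g2: "gauge \<gamma>2" "\<forall>\<D>. \<D> tagged_division_of (cbox a b) \<and> \<gamma>2 fine \<D> \<longrightarrow>
      norm ((\<Sum>(x, k)\<in>\<D>. measure lborel k *\<^sub>R g x) - z) < d"
    using g[unfolded has_integral, rule_format, OF d(1)] by blast
  obtain p where p: "p tagged_division_of cbox a b" "(\<lambda>x. \<gamma>1 x \<inter> \<gamma>2 x) fine p"
    using fine_division_exists[OF gauge_Int[OF g1(1) g2(1)]] by metis
  have fin: "finite p" using p(1) by (rule tagged_division_of_finite)
  define s where "s = (\<Sum>(x, k)\<in>p. measure lborel k *\<^sub>R f x)"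
  have s1: "norm (s - y) < d" unfolding s_def using g1(2) p by (simp add: fine_Int)
  have s2: "(\<Sum>(x, k)\<in>p. measure lborel k *\<^sub>R g x) < z + d"
    using g2(2)[rule_format, of p] p by (simp add: fine_Int abs_less_iff)
  have "N s \<le> (\<Sum>(x, k)\<in>p. measure lborel k * N (f x))"
    unfolding s_def using sum[OF fin, of "\<lambda>(x, k). measure lborel k *\<^sub>R f x"]
    by (simp add: case_prod_unfold scale)
  also have "\<dots> \<le> (\<Sum>(x, k)\<in>p. measure lborel k *\<^sub>R g x)"
  proof (intro sum_mono, clarify)
    fix x k assume "(x, k) \<in> p"
    then have "x \<in> cbox a b" using p(1) by (meson tagged_division_ofD(2,3) subsetD)
    then show "measure lborel k * N (f x) \<le> measure lborel k *\<^sub>R g x"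
      using le by (simp add: mult_left_mono)
  qed
  finally have "N s < z + d" using s2 by linarith
  moreover have "N (y - s) \<le> C * d"
    using bdd(1)[of "y - s"] mult_left_mono[OF less_imp_le[OF s1] bdd(2)] by (simp add: norm_minus_commute)
  moreover have "N y \<le> N s + N (y - s)" using add[of s "y - s"] by simp
  ultimately show "N y \<le> z + e" using d(2) by linarith
qed

lemma finite_positive_lower_bound:
  fixes L :: "real set"
  assumes "finite L" "\<And>l. l \<in> L \<Longrightarrow> 0 < l"
  obtains m where "0 < m" "\<And>l. l \<in> L \<Longrightarrow> m \<le> l"
proof (cases "L = {}")
  case True
  then show ?thesis using that[of 1] by simp
next
  case False
  then show ?thesis using that[of "Min L"] assms by simp
qed

text \<open>The rate m is a positive lower bound of the spectrum. For oblique idempotents the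
  constant C need not be 1, so it is taken to be the sum of their operator norms.\<close>

lemma fcalc_exp_decay:
  assumes res: "spectral_resolution L E" and pos: "\<And>l. l \<in> L \<Longrightarrow> 0 < l"
  obtains C m where "0 < m" "0 \<le> C" "\<And>t. 0 \<le> t \<Longrightarrow> op_norm (fcalc L E (\<lambda>l. exp (- t * l))) \<le> C * exp (- m * t)"
proof -
  have fin: "finite L" using res by (simp add: spectral_resolution_def)
  obtain m where m: "0 < m" "\<And>l. l \<in> L \<Longrightarrow> m \<le> l"
    using finite_positive_lower_bound[OF fin pos] by blast
  define C where "C = (\<Sum>l\<in>L. op_norm (E l))"
  have "op_norm (fcalc L E (\<lambda>l. exp (- t * l))) \<le> C * exp (- m * t)" if "0 \<le> t" for t
  proof -
    have "op_norm (fcalc L E (\<lambda>l. exp (- t * l))) \<le> (\<Sum>l\<in>L. exp (- t * l) * op_norm (E l))"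
      unfolding fcalc_def using op_norm_sum[OF fin, of "\<lambda>l. exp (- t * l) *\<^sub>R E l"]
      by (simp add: op_norm_scaleR)
    also have "\<dots> \<le> (\<Sum>l\<in>L. exp (- m * t) * op_norm (E l))"
      using m(2) that by (intro sum_mono mult_right_mono) (simp_all add: mult.commute[of t] mult_right_mono)
    finally show ?thesis by (simp add: C_def sum_distrib_left mult.commute)
  qed
  then show ?thesis using that[OF m(1), of C] by (simp add: C_def sum_nonneg)
qed

lemma continuous_on_op_norm:
  fixes f :: "'a::topological_space \<Rightarrow> complex^'n^'n"
  assumes "continuous_on X f"
  shows "continuous_on X (\<lambda>x. op_norm (f x))"
proof -
  obtain K where K: "K > 0" "\<And>A::complex^'n^'n. op_norm A \<le> norm A * K"
    using op_norm_le_norm by blast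
  have "\<bar>op_norm A - op_norm B\<bar> \<le> op_norm (A - B)" for A B :: "complex^'n^'n"
    using op_norm_add[of "A - B" B] op_norm_add[of "B - A" A] op_norm_scaleR[of "-1" "A - B"] by simp
  then have "K-lipschitz_on UNIV (op_norm :: complex^'n^'n \<Rightarrow> real)"
    using K by (intro lipschitz_onI) (auto simp: dist_norm mult.commute intro: order.trans)
  then show ?thesis
    using continuous_on_compose2[OF lipschitz_on_continuous_on assms] by blast
qed

lemma fcalc_exp_has_vector_derivative:
  assumes res: "spectral_resolution L E"
  shows "((\<lambda>t. fcalc L E (\<lambda>l. exp (- t * l))) has_vector_derivative
    - (fcalc L E (\<lambda>l. l) ** fcalc L E (\<lambda>l. exp (- t * l)))) (at t within X)"
proof -
  have "((\<lambda>t. exp (- t * l) *\<^sub>R E l) has_vector_derivative (- l * exp (- t * l)) *\<^sub>R E l) (at t within X)" for l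
    by (auto intro!: derivative_eq_intros)
  then have "((\<lambda>t. \<Sum>l\<in>L. exp (- t * l) *\<^sub>R E l) has_vector_derivative
      (\<Sum>l\<in>L. (- l * exp (- t * l)) *\<^sub>R E l)) (at t within X)"
    by (intro has_vector_derivative_sum)
  moreover have "(\<Sum>l\<in>L. (- l * exp (- t * l)) *\<^sub>R E l) =
      - (fcalc L E (\<lambda>l. l) ** fcalc L E (\<lambda>l. exp (- t * l)))"
    by (simp add: fcalc_mult[OF res]) (simp add: fcalc_def sum_negf)
  moreover have "(\<lambda>t. fcalc L E (\<lambda>l. exp (- t * l))) = (\<lambda>t. \<Sum>l\<in>L. exp (- t * l) *\<^sub>R E l)"
    by (simp add: fcalc_def)
  ultimately show ?thesis by (simp only:)
qed

theorem sylvester_norm_bound: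
  fixes N :: "complex^'n^'n \<Rightarrow> real"
  assumes N: "unitarily_invariant_norm N"
    and res: "spectral_resolution L E" and pos: "\<And>l. l \<in> L \<Longrightarrow> 0 < l" and S: "S = fcalc L E (\<lambda>l. l)"
  shows "N D \<le> integral {0..} (\<lambda>t. (op_norm (mat_exp ((- t) *\<^sub>R S)))\<^sup>2) * N (conj_transpose S ** D + D ** S)"
proof -
  have MN: "matrix_norm N" using N by (simp add: unitarily_invariant_norm_def)
  note P = matrix_norm_props[OF MN]
  obtain C where C: "C \<ge> 0" "\<And>A. N A \<le> C * norm A"
    using matrix_norm_le_norm[OF MN] by blast
  define e where "e t = fcalc L E (\<lambda>l. exp (- t * l))" for t
  have exp_e: "mat_exp ((- t) *\<^sub>R S) = e t" for t
    unfolding S fcalc_scaleR mat_exp_fcalc[OF res] e_def ..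
  have com: "S ** e t = e t ** S" for t
    by (simp add: S e_def fcalc_mult[OF res] mult.commute)
  have "e t ** e (- t) = mat 1" for t
    by (simp add: e_def fcalc_mult[OF res] fcalc_1[OF res] flip: exp_add)
  \<comment> \<open>The congruence inequality for N is available for invertible factors, and
    \<open>e (- t)\<close> inverts \<open>e t\<close>.\<close>
  then have inv: "invertible (e t)" for t
    using invertible_right_inverse by blast
  have e_deriv: "(e has_vector_derivative - (S ** e t)) (at t within X)" for t X
    using fcalc_exp_has_vector_derivative[OF res] by (simp add: e_def[abs_def] S)
  have ce_deriv: "((\<lambda>t. conj_transpose (e t)) has_vector_derivative conj_transpose (- (S ** e t))) (at t within X)" for t X
    using bounded_linear.has_vector_derivative[OF _ e_deriv, of conj_transpose] linear_conj_transpose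
    by (simp add: linear_conv_bounded_linear)
  have cont_e: "continuous_on X e" for X
    unfolding continuous_on_eq_continuous_within
    using has_vector_derivative_continuous[OF e_deriv] by blast
  define w where "w t = (op_norm (e t))\<^sup>2" for t
  define R where "R = conj_transpose S ** D + D ** S"
  define \<Phi> where "\<Phi> t = conj_transpose (e t) ** D ** e t" for t
  have \<Phi>_deriv: "(\<Phi> has_vector_derivative - (conj_transpose (e t) ** R ** e t)) (at t within X)" for t X
  proof -
    have "(\<Phi> has_vector_derivative (conj_transpose (e t) ** D) ** (- (S ** e t))
        + (conj_transpose (- (S ** e t)) ** D) ** e t) (at t within X)"
      unfolding \<Phi>_def
      by (intro mm.has_vector_derivative e_deriv
          bounded_linear.has_vector_derivative[OF mm.bounded_linear_left ce_deriv])
    moreover have "(conj_transpose (e t) ** D) ** (- (S ** e t))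
        + (conj_transpose (- (S ** e t)) ** D) ** e t = - (conj_transpose (e t) ** R ** e t)"
      by (simp add: R_def conj_transpose_uminus conj_transpose_mult mm.minus_left mm.minus_right
          mm.add_left mm.add_right matrix_mul_assoc)
    ultimately show ?thesis by simp
  qed
  have cont_w: "continuous_on X w" for X
    unfolding w_def by (intro continuous_intros continuous_on_op_norm cont_e)
  obtain M m where Mm: "0 < m" "0 \<le> M" "\<And>t. 0 \<le> t \<Longrightarrow> op_norm (e t) \<le> M * exp (- m * t)"
    using fcalc_exp_decay[OF res pos] unfolding e_def by blast
  have w_le: "w t \<le> M\<^sup>2 * exp (- (2 * m) * t)" if "0 \<le> t" for t
  proof -
    have "w t \<le> (M * exp (- m * t))\<^sup>2"
      unfolding w_def using Mm(3)[OF that] by (intro power_mono) auto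
    then show ?thesis by (simp add: power_mult_distrib power2_eq_square mult_ac flip: exp_add)
  qed
  \<comment> \<open>A non-integrable function has integral 0 by convention, so integrability is what
    makes the half-line integral an upper bound for those over \<open>{0..T}\<close>.\<close>
  have w_int: "w integrable_on {0..}"
  proof (rule measurable_bounded_by_integrable_imp_integrable)
    show "w \<in> borel_measurable (lebesgue_on {0..})"
      by (intro continuous_imp_measurable_on_sets_lebesgue cont_w) auto
    show "(\<lambda>t. M\<^sup>2 * exp (- (2 * m) * t)) integrable_on {0..}"
      using integrable_on_exp_minus_to_infinity[of "2 * m" 0] Mm(1) by (intro integrable_on_mult_right) auto
    show "norm (w t) \<le> M\<^sup>2 * exp (- (2 * m) * t)" if "t \<in> {0..}" for t
      using w_le[of t] that by (simp add: w_def)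
  qed auto
  \<comment> \<open>The matrix integral is taken only over finite intervals: D is
    \<open>\<Phi> T\<close> plus an integral over \<open>{0..T}\<close>, and the remainder
    \<open>w T * N D\<close> disappears in the limit of large T.\<close>
  have step: "N D \<le> integral {0..} w * N R + w T * N D" if "0 \<le> T" for T
  proof -
    have int_T: "w integrable_on {0..T}"
      by (intro integrable_continuous_real cont_w)
    have "((\<lambda>t. - (conj_transpose (e t) ** R ** e t)) has_integral (\<Phi> T - \<Phi> 0)) (cbox 0 T)"
      unfolding cbox_interval by (intro fundamental_theorem_of_calculus that \<Phi>_deriv)
    moreover have "((\<lambda>t. w t * N R) has_integral (integral {0..T} w * N R)) (cbox 0 T)"
      unfolding cbox_interval by (intro has_integral_mult_left integrable_integral int_T)
    moreover have "N (- (conj_transpose (e t) ** R ** e t)) \<le> w t * N R" for t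
      using unitarily_invariant_norm_congruence[OF N inv, of t R] P(3)[of "-1"] by (simp add: w_def)
    ultimately have "N (\<Phi> T - \<Phi> 0) \<le> integral {0..T} w * N R"
      using seminorm_integral_bound[of N C, OF P(4) P(3) C(2) C(1)] by blast
    also have "\<dots> \<le> integral {0..} w * N R"
      by (intro mult_right_mono integral_subset_le int_T w_int P(1)) (auto simp: w_def)
    finally have "N (\<Phi> 0 - \<Phi> T) \<le> integral {0..} w * N R" by (simp add: P(5)[of "\<Phi> 0"])
    moreover have "N (\<Phi> T) \<le> w T * N D"
      unfolding \<Phi>_def w_def by (rule unitarily_invariant_norm_congruence[OF N inv])
    moreover have "\<Phi> 0 = D"
      by (simp add: \<Phi>_def e_def fcalc_1[OF res])
    ultimately show ?thesis using P(4)[of "D - \<Phi> T" "\<Phi> T"] by simp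
  qed
  have "(w \<longlongrightarrow> 0) at_top"
  proof (rule tendsto_sandwich)
    show "eventually (\<lambda>t. 0 \<le> w t) at_top" by (simp add: w_def)
    show "eventually (\<lambda>t. w t \<le> M\<^sup>2 * exp (- (2 * m) * t)) at_top"
      using eventually_ge_at_top[of 0] by eventually_elim (rule w_le)
    have "filterlim (\<lambda>t. (2 * m) * t) at_top at_top"
      using Mm(1) by (intro filterlim_tendsto_pos_mult_at_top[OF tendsto_const] filterlim_ident) auto
    then have "((\<lambda>t. exp (- (2 * m) * t)) \<longlongrightarrow> 0) at_top"
      by (intro filterlim_compose[OF exp_at_bot]) (simp add: filterlim_uminus_at_bot)
    then show "((\<lambda>t. M\<^sup>2 * exp (- (2 * m) * t)) \<longlongrightarrow> 0) at_top"
      by (rule tendsto_mult_right_zero)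
  qed simp
  then have "((\<lambda>T. integral {0..} w * N R + w T * N D) \<longlongrightarrow> integral {0..} w * N R + 0 * N D) at_top"
    by (intro tendsto_intros)
  then have "N D \<le> integral {0..} w * N R + 0 * N D"
    by (rule tendsto_lowerbound)
      (use step in \<open>auto intro: eventually_mono[OF eventually_ge_at_top[of 0]]\<close>)
  then show ?thesis unfolding exp_e by (simp add: R_def w_def[abs_def])
qed

section \<open>Continuity of the square root and the Riccati equation\<close>

text \<open>The Rayleigh quotient is maximized for the square of D, where it equals the squared
  length of D x on unit vectors. That catches the eigenvalue of largest absolute value whatever its
  sign.\<close>

lemma hermitian_eigenvector_op_norm:
  fixes D :: "complex^'n^'n"
  assumes "hermitian_mat D"
  obtains v l where "norm v = 1" "D *v v = l *\<^sub>R v" "op_norm D \<le> \<bar>l\<bar>"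
proof -
  have sa: "x \<bullet> (D *v y) = (D *v x) \<bullet> y" for x y
    by (rule hermitian_mat_inner[OF assms])
  have sa2: "x \<bullet> (D *v (D *v y)) = (D *v (D *v x)) \<bullet> y" for x y
    by (simp only: sa)
  have "axis undefined 1 \<noteq> (0 :: complex^'n)" by (simp add: axis_eq_0_iff)
  then have ne: "(UNIV :: (complex^'n) set) \<noteq> {0}" by blast
  have lin: "linear (\<lambda>x. D *v (D *v x))"
    by (simp add: matrix_vector_mul_assoc)
  obtain v k where v: "norm v = 1" "D *v (D *v v) = k *\<^sub>R v"
    and max: "\<And>x. x \<bullet> (D *v (D *v x)) \<le> k * (x \<bullet> x)"
    by (rule self_adjoint_eigenvector[OF lin sa2 subspace_UNIV ne subset_UNIV]) (rule that; simp)
  have sq: "(norm (D *v x))\<^sup>2 \<le> k * (norm x)\<^sup>2" for x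
    using max[of x] by (simp add: sa power2_norm_eq_inner)
  have k: "k \<ge> 0"
    using order.trans[OF zero_le_power2 sq[of v]] v(1) by simp
  define l where "l = sqrt k"
  have l: "l \<ge> 0" "l * l = k" using k by (simp_all add: l_def)
  have op: "op_norm D \<le> l"
  proof (rule op_norm_le)
    fix x
    have "(norm (D *v x))\<^sup>2 \<le> (l * norm x)\<^sup>2"
      using sq[of x] by (simp add: power2_eq_square l(2)[symmetric] mult_ac)
    then show "norm (D *v x) \<le> l * norm x"
      by (rule power2_le_imp_le) (use l in simp)
  qed
  \<comment> \<open>From \<open>(D - l) (D + l) v = 0\<close>, either \<open>v\<close> or \<open>(D + l) v\<close> is an eigenvector of \<open>D\<close>.\<close>
  define u where "u = D *v v + l *\<^sub>R v"
  show ?thesis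
  proof (cases "u = 0")
    case True
    then have "D *v v = (- l) *\<^sub>R v" by (simp add: u_def eq_neg_iff_add_eq_0)
    then show ?thesis using that[of v "- l"] v(1) op l by simp
  next
    case False
    have "D *v u = l *\<^sub>R u"
      by (simp add: u_def mv.add_right mv.scaleR_right v scaleR_add_right l)
    then have "D *v (u /\<^sub>R norm u) = l *\<^sub>R (u /\<^sub>R norm u)"
      by (simp add: mv.scaleR_right)
    then show ?thesis using that[of "u /\<^sub>R norm u" l] False op l by simp
  qed
qed

lemma pos_def_lower_bound:
  assumes "pos_def_mat P"
  obtains m where "0 < m" "\<And>x. m * (x \<bullet> x) \<le> x \<bullet> (P *v x)"
proof -
  obtain L E where res: "spectral_resolution L E" and P: "P = fcalc L E (\<lambda>l. l)"
    and herm: "\<And>l. l \<in> L \<Longrightarrow> hermitian_mat (E l)" and pos: "\<And>l. l \<in> L \<Longrightarrow> 0 < l"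
    using pos_def_spectral[OF assms] by metis
  have fin: "finite L" using res by (simp add: spectral_resolution_def)
  obtain m where m: "0 < m" "\<And>l. l \<in> L \<Longrightarrow> m \<le> l"
    using finite_positive_lower_bound[OF fin pos] by blast
  have "m * (x \<bullet> x) \<le> x \<bullet> (P *v x)" for x
  proof -
    have "fcalc L E (\<lambda>_. m) = m *\<^sub>R mat 1"
      using fcalc_scaleR[of m L E "\<lambda>_. 1"] by (simp add: fcalc_1[OF res])
    then have "m * (x \<bullet> x) = x \<bullet> (fcalc L E (\<lambda>_. m) *v x)"
      by (simp add: mv.scaleR_left)
    also have "\<dots> \<le> x \<bullet> (P *v x)"
      using m by (simp add: P fcalc_quadratic_form[OF res herm] sum_mono mult_right_mono)
    finally show ?thesis .
  qed
  then show ?thesis using that m(1) by blast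
qed

lemma norm_inner_le_op_norm: "\<bar>x \<bullet> (A *v x)\<bar> \<le> op_norm A * (x \<bullet> x)"
proof -
  have "\<bar>x \<bullet> (A *v x)\<bar> \<le> norm x * norm (A *v x)" by (rule Cauchy_Schwarz_ineq2)
  also have "\<dots> \<le> norm x * (op_norm A * norm x)"
    by (intro mult_left_mono norm_matrix_vector_le_op_norm) simp
  finally show ?thesis by (simp add: dot_square_norm power2_eq_square mult_ac)
qed

text \<open>For a unit eigenvector \<open>v\<close> of \<open>T - S\<close> with eigenvalue \<open>l\<close>, the factorization
  \<open>T\<^sup>2 - S\<^sup>2 = T (T - S) + (T - S) S\<close> gives \<open>v\<^sup>* (T\<^sup>2 - S\<^sup>2) v = l (v\<^sup>* T v + v\<^sup>* S v)\<close>.\<close>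

lemma pos_def_square_diff:
  assumes S: "pos_def_mat S" "\<And>x. m * (x \<bullet> x) \<le> x \<bullet> (S *v x)" and T: "pos_def_mat T"
  shows "m * op_norm (T - S) \<le> op_norm (T ** T - S ** S)"
proof (cases "m \<ge> 0")
  case True
  have herm: "hermitian_mat (T - S)" using S T by (simp add: pos_def_mat_iff hermitian_mat_diff)
  obtain v l where v: "norm v = 1" "(T - S) *v v = l *\<^sub>R v" "op_norm (T - S) \<le> \<bar>l\<bar>"
    by (rule hermitian_eigenvector_op_norm[OF herm])
  have vv: "v \<bullet> v = 1" using v(1) by (simp add: dot_square_norm)
  then have "v \<noteq> 0" by auto
  then have Tv: "v \<bullet> (T *v v) > 0" using T by (simp add: pos_def_mat_iff)
  have Sv: "v \<bullet> (S *v v) \<ge> m" using S(2)[of v] vv by simp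
  have "T ** T - S ** S = T ** (T - S) + (T - S) ** S"
    by (simp add: mm.diff_left mm.diff_right)
  then have "v \<bullet> ((T ** T - S ** S) *v v) = v \<bullet> (T *v ((T - S) *v v)) + ((T - S) *v v) \<bullet> (S *v v)"
    by (simp add: mv.add_left inner_add_right hermitian_mat_inner[OF herm] flip: matrix_vector_mul_assoc)
  also have "\<dots> = l * (v \<bullet> (T *v v) + v \<bullet> (S *v v))"
    by (simp add: v mv.scaleR_right ring_distribs)
  finally have "\<bar>l\<bar> * (v \<bullet> (T *v v) + v \<bullet> (S *v v)) = \<bar>v \<bullet> ((T ** T - S ** S) *v v)\<bar>"
    using Tv Sv True by (simp add: abs_mult)
  also have "\<dots> \<le> op_norm (T ** T - S ** S)"
    using norm_inner_le_op_norm[of v "T ** T - S ** S"] vv by simp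
  finally have "\<bar>l\<bar> * (v \<bullet> (T *v v) + v \<bullet> (S *v v)) \<le> op_norm (T ** T - S ** S)" .
  moreover have "m * op_norm (T - S) \<le> (v \<bullet> (T *v v) + v \<bullet> (S *v v)) * \<bar>l\<bar>"
    using Tv Sv True v(3) by (intro mult_mono) auto
  ultimately show ?thesis by (simp add: mult.commute)
next
  case False
  then show ?thesis using op_norm_nonneg[of "T - S"] op_norm_nonneg[of "T ** T - S ** S"]
    by (smt (verit) mult_nonneg_nonneg minus_mult_left)
qed

section \<open>Limits of square roots, inverses and positive definite matrices\<close>

lemma component_le_op_norm: "norm (A $ i $ j) \<le> op_norm A"
proof -
  have "norm (A $ i $ j) = norm ((A *v axis j 1) $ i)"
    by (simp add: matrix_vector_mult_def axis_def if_distrib cong: if_cong)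
  also have "\<dots> \<le> norm (A *v axis j 1)" by (rule Finite_Cartesian_Product.norm_nth_le)
  also have "\<dots> \<le> op_norm A"
    using norm_matrix_vector_le_op_norm[of A "axis j 1"] by simp
  finally show ?thesis .
qed

lemma tendsto_op_norm_iff:
  fixes M :: "'a \<Rightarrow> complex^'n^'n"
  shows "(M \<longlongrightarrow> P) F \<longleftrightarrow> ((\<lambda>t. op_norm (M t - P)) \<longlongrightarrow> 0) F"
proof
  assume M: "(M \<longlongrightarrow> P) F"
  obtain K where K: "K > 0" "\<And>A::complex^'n^'n. op_norm A \<le> norm A * K"
    using op_norm_le_norm by blast
  have lim: "((\<lambda>t. norm (M t - P) * K) \<longlongrightarrow> 0) F"
    using M by (intro tendsto_mult_left_zero tendsto_norm_zero) (simp add: LIM_zero)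
  show "((\<lambda>t. op_norm (M t - P)) \<longlongrightarrow> 0) F"
    by (rule tendsto_sandwich[OF _ _ tendsto_const lim]) (use K in simp_all)
next
  assume *: "((\<lambda>t. op_norm (M t - P)) \<longlongrightarrow> 0) F"
  have "((\<lambda>t. (M t - P) $ i $ j) \<longlongrightarrow> 0) F" for i j
    by (rule Lim_null_comparison[OF _ *]) (simp only: component_le_op_norm eventually_True)
  then show "(M \<longlongrightarrow> P) F"
    by (intro vec_tendstoI) (simp add: LIM_zero_iff)
qed

text \<open>In \<open>pos_def_square_diff\<close> the constant m depends only on the root of the
  limit P, so no uniform lower bound along M is involved.\<close>

lemma pd_sqrt_tendsto:
  assumes M: "(M \<longlongrightarrow> P) F" and pd: "eventually (\<lambda>t. pos_def_mat (M t)) F" "pos_def_mat P"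
  shows "((\<lambda>t. pd_sqrt (M t)) \<longlongrightarrow> pd_sqrt P) F"
proof -
  obtain m where m: "0 < m" "\<And>x. m * (x \<bullet> x) \<le> x \<bullet> (pd_sqrt P *v x)"
    using pos_def_lower_bound[OF pos_def_pd_sqrt(1)[OF pd(2)]] by blast
  have lim: "((\<lambda>t. op_norm (M t - P) / m) \<longlongrightarrow> 0) F"
    using M unfolding tendsto_op_norm_iff by (rule tendsto_divide_zero)
  have le: "eventually (\<lambda>t. op_norm (pd_sqrt (M t) - pd_sqrt P) \<le> op_norm (M t - P) / m) F"
    using pd(1)
  proof eventually_elim
    case (elim t)
    from pos_def_square_diff[OF pos_def_pd_sqrt(1)[OF pd(2)] m(2) pos_def_pd_sqrt(1)[OF elim]]
    show ?case using m(1) by (simp add: pos_def_pd_sqrt(2) elim pd(2) field_simps)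
  qed
  show ?thesis
    unfolding tendsto_op_norm_iff[of "\<lambda>t. pd_sqrt (M t)"]
    by (rule tendsto_sandwich[OF _ le tendsto_const lim]) simp
qed

lemma op_norm_mult: "op_norm (A ** B) \<le> op_norm A * op_norm B"
proof (rule op_norm_le)
  fix x
  have "norm (A *v (B *v x)) \<le> op_norm A * norm (B *v x)"
    by (rule norm_matrix_vector_le_op_norm)
  also have "\<dots> \<le> op_norm A * (op_norm B * norm x)"
    by (intro mult_left_mono norm_matrix_vector_le_op_norm) simp
  finally show "norm ((A ** B) *v x) \<le> op_norm A * op_norm B * norm x"
    by (simp add: matrix_vector_mul_assoc mult.assoc)
qed

lemma matrix_inv_diff:
  fixes A B :: "complex^'n^'n"
  assumes "invertible A" "invertible B"
  shows "matrix_inv A - matrix_inv B = matrix_inv B ** (B - A) ** matrix_inv A"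
  by (simp add: mm.diff_left mm.diff_right matrix_inv_inverse assms)
     (metis assms matrix_inv_inverse(1) matrix_mul_assoc matrix_mul_rid)

lemma matrix_inv_tendsto:
  fixes M :: "'a \<Rightarrow> complex^'n^'n"
  assumes M: "(M \<longlongrightarrow> P) F" and inv: "eventually (\<lambda>t. invertible (M t)) F" "invertible P"
  shows "((\<lambda>t. matrix_inv (M t)) \<longlongrightarrow> matrix_inv P) F"
proof -
  define a where "a = op_norm (matrix_inv P)"
  have a: "a > 0" unfolding a_def by (rule op_norm_invertible_pos[OF invertible_matrix_inv[OF inv(2)]])
  have M0: "((\<lambda>t. op_norm (M t - P)) \<longlongrightarrow> 0) F" using M by (simp flip: tendsto_op_norm_iff)
  have lim: "((\<lambda>t. 2 * a * a * op_norm (M t - P)) \<longlongrightarrow> 0) F"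
    by (rule tendsto_mult_right_zero[OF M0])
  \<comment> \<open>With b the norm of the inverse of M t and d the distance to P,
    \<open>matrix_inv_diff\<close> bounds the difference of inverses by \<open>a * d * b\<close>.
    Below the threshold this is at most b / 2, so b is at most b / 2 + a, hence at most 2 a;
    reinserting that bound gives \<open>2 * a * a * d\<close>.\<close>
  have "eventually (\<lambda>t. op_norm (M t - P) < 1 / (2 * a)) F"
    using M0 by (rule order_tendstoD) (use a in simp)
  then have le: "eventually (\<lambda>t. op_norm (matrix_inv (M t) - matrix_inv P) \<le> 2 * a * a * op_norm (M t - P)) F"
    using inv(1)
  proof eventually_elim
    case (elim t)
    define b where "b = op_norm (matrix_inv (M t))"
    define d where "d = op_norm (M t - P)"
    have d: "0 \<le> d" "a * d \<le> 1 / 2" using elim(1) a by (simp_all add: d_def field_simps)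
    have "op_norm (matrix_inv (M t) - matrix_inv P) \<le> op_norm (matrix_inv P ** (P - M t)) * b"
      unfolding matrix_inv_diff[OF elim(2) inv(2)] b_def by (rule op_norm_mult)
    also have "\<dots> \<le> (a * op_norm (P - M t)) * b"
      unfolding a_def by (intro mult_right_mono op_norm_mult) (simp add: b_def)
    also have "op_norm (P - M t) = d"
      using op_norm_scaleR[of "-1" "M t - P"] by (simp add: d_def)
    finally have bound: "op_norm (matrix_inv (M t) - matrix_inv P) \<le> (a * d) * b" .
    also have "\<dots> \<le> (1 / 2) * b" using d by (intro mult_right_mono) (simp_all add: b_def)
    finally have "b \<le> 2 * a"
      using op_norm_add[of "matrix_inv (M t) - matrix_inv P" "matrix_inv P"] by (simp add: a_def b_def)
    then have "(a * d) * b \<le> (a * d) * (2 * a)" using a d by (intro mult_left_mono) auto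
    then show ?case using bound by (simp add: d_def mult_ac)
  qed
  show ?thesis
    unfolding tendsto_op_norm_iff[of "\<lambda>t. matrix_inv (M t)"]
    by (rule tendsto_sandwich[OF _ le tendsto_const lim]) simp
qed

lemma eventually_pos_def:
  assumes M: "(M \<longlongrightarrow> P) F" and herm: "eventually (\<lambda>t. hermitian_mat (M t)) F" and pd: "pos_def_mat P"
  shows "eventually (\<lambda>t. pos_def_mat (M t)) F"
proof -
  obtain m where m: "0 < m" "\<And>x. m * (x \<bullet> x) \<le> x \<bullet> (P *v x)"
    using pos_def_lower_bound[OF pd] by blast
  have "eventually (\<lambda>t. op_norm (M t - P) < m) F"
    using M m(1) unfolding tendsto_op_norm_iff by (auto dest: order_tendstoD)
  then show ?thesis using herm
  proof eventually_elim
    case (elim t)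
    have "0 < x \<bullet> (M t *v x)" if "x \<noteq> 0" for x
    proof -
      have "op_norm (M t - P) * (x \<bullet> x) < m * (x \<bullet> x)" using elim(1) that by simp
      then have "\<bar>x \<bullet> ((M t - P) *v x)\<bar> < x \<bullet> (P *v x)"
        using norm_inner_le_op_norm[of x "M t - P"] m(2)[of x] by linarith
      then show ?thesis by (simp add: mv.diff_left inner_diff_right)
    qed
    then show ?case using elim(2) by (simp add: pos_def_mat_iff)
  qed
qed

section \<open>Algebra of the geometric mean\<close>

lemma invertible_pd_sqrt: "pos_def_mat A \<Longrightarrow> invertible (pd_sqrt A)"
  by (intro pos_def_invertible pos_def_pd_sqrt)

lemma matrix_inv_pd_sqrt:
  assumes "pos_def_mat A"
  shows "matrix_inv A = matrix_inv (pd_sqrt A) ** matrix_inv (pd_sqrt A)"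
proof (rule matrix_inv_eqI)
  note inv = matrix_inv_inverse(1)[OF invertible_pd_sqrt[OF assms]]
  show "A ** (matrix_inv (pd_sqrt A) ** matrix_inv (pd_sqrt A)) = mat 1"
    using pos_def_pd_sqrt(2)[OF assms] inv by (metis matrix_mul_assoc matrix_mul_rid)
qed

lemma pos_def_geom_mean_inner:
  assumes "pos_def_mat A" "pos_def_mat B"
  shows "pos_def_mat (matrix_inv (pd_sqrt A) ** B ** matrix_inv (pd_sqrt A))"
proof -
  have Q: "pos_def_mat (pd_sqrt A)" using assms(1) by (rule pos_def_pd_sqrt)
  note inv = invertible_pd_sqrt[OF assms(1)]
  have "hermitian_mat (matrix_inv (pd_sqrt A))"
    using Q by (intro hermitian_mat_inv inv) (simp add: pos_def_mat_iff)
  with inv show ?thesis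
    using pos_def_congruence[OF assms(2) invertible_matrix_inv[of "pd_sqrt A"]]
    by (simp add: hermitian_mat_def)
qed

lemma pos_def_geom_mean:
  assumes "pos_def_mat A" "pos_def_mat B"
  shows "pos_def_mat (geom_mean A B)"
proof -
  have Q: "pos_def_mat (pd_sqrt A)" using assms(1) by (rule pos_def_pd_sqrt)
  show ?thesis
    using pos_def_congruence[OF pos_def_pd_sqrt(1)[OF pos_def_geom_mean_inner[OF assms]]
        pos_def_invertible[OF Q]] Q
    by (simp add: geom_mean_def hermitian_mat_def pos_def_mat_iff)
qed

text \<open>One factor of the inverse of A cancels the left factor \<open>pd_sqrt A\<close>. The
  right-hand side is visibly the conjugate of a positive definite matrix by
  \<open>pd_sqrt A\<close>, from which the spectral resolution is transported.\<close>

lemma matrix_inv_mult_geom_mean: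
  fixes A B :: "complex^'n^'n"
  assumes "pos_def_mat A" "pos_def_mat B"
  shows "matrix_inv A ** geom_mean A B = matrix_inv (pd_sqrt A) **
      pd_sqrt (matrix_inv (pd_sqrt A) ** B ** matrix_inv (pd_sqrt A)) ** pd_sqrt A"
proof -
  define Q where "Q = pd_sqrt A"
  define V where "V = matrix_inv Q"
  have "invertible Q" unfolding Q_def by (rule invertible_pd_sqrt[OF assms(1)])
  then have QV: "Q ** V = mat 1" "V ** Q = mat 1" by (simp_all add: V_def matrix_inv_inverse)
  have Ai: "matrix_inv A = V ** V"
    unfolding V_def Q_def by (rule matrix_inv_pd_sqrt[OF assms(1)])
  have "V ** V ** (Q ** W ** Q) = V ** W ** Q" for W
    using QV by (metis matrix_mul_assoc matrix_mul_rid)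
  then show ?thesis
    unfolding Ai geom_mean_def Q_def[symmetric] V_def[symmetric] .
qed

lemma matrix_inv_mult_geom_mean_square:
  fixes A B :: "complex^'n^'n"
  assumes "pos_def_mat A" "pos_def_mat B"
  shows "(matrix_inv A ** geom_mean A B) ** (matrix_inv A ** geom_mean A B) = matrix_inv A ** B"
proof -
  define Q where "Q = pd_sqrt A"
  define V where "V = matrix_inv Q"
  define P where "P = pd_sqrt (V ** B ** V)"
  have "invertible Q" unfolding Q_def by (rule invertible_pd_sqrt[OF assms(1)])
  then have QV: "Q ** V = mat 1" "V ** Q = mat 1" by (simp_all add: V_def matrix_inv_inverse)
  have Ai: "matrix_inv A = V ** V"
    unfolding V_def Q_def by (rule matrix_inv_pd_sqrt[OF assms(1)])
  have PP: "P ** P = V ** B ** V"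
    unfolding P_def V_def Q_def by (rule pos_def_pd_sqrt(2)[OF pos_def_geom_mean_inner[OF assms]])
  have "(V ** P ** Q) ** (V ** P ** Q) = V ** (P ** P) ** Q"
    using QV by (metis matrix_mul_assoc matrix_mul_rid)
  also have "\<dots> = V ** V ** B"
    unfolding PP using QV by (metis matrix_mul_assoc matrix_mul_rid)
  finally show ?thesis
    unfolding matrix_inv_mult_geom_mean[OF assms] unfolding Ai P_def V_def Q_def .
qed

lemma geom_mean_riccati:
  assumes "pos_def_mat A" "pos_def_mat B"
  shows "geom_mean A B ** matrix_inv A ** geom_mean A B = B"
proof -
  have "A ** matrix_inv A = mat 1" by (rule matrix_inv_inverse[OF pos_def_invertible[OF assms(1)]])
  then show ?thesis
    using arg_cong[OF matrix_inv_mult_geom_mean_square[OF assms], of "(**) A"]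
    by (simp add: matrix_mul_assoc)
qed

lemma matrix_inv_mult_geom_mean_spectral:
  fixes A B :: "complex^'n^'n"
  assumes "pos_def_mat A" "pos_def_mat B"
  obtains L E where "spectral_resolution L E" "\<And>l. l \<in> L \<Longrightarrow> 0 < l"
    "matrix_inv A ** geom_mean A B = fcalc L E (\<lambda>l. l)"
proof -
  define Q where "Q = pd_sqrt A"
  define V where "V = matrix_inv Q"
  have "invertible Q" unfolding Q_def by (rule invertible_pd_sqrt[OF assms(1)])
  then have QV: "Q ** V = mat 1" "V ** Q = mat 1" by (simp_all add: V_def matrix_inv_inverse)
  have "pos_def_mat (pd_sqrt (V ** B ** V))"
    unfolding V_def Q_def by (rule pos_def_pd_sqrt(1)[OF pos_def_geom_mean_inner[OF assms]])
  then obtain L E where LE: "spectral_resolution L E" "pd_sqrt (V ** B ** V) = fcalc L E (\<lambda>l. l)"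
    "\<And>l. l \<in> L \<Longrightarrow> 0 < l"
    using pos_def_spectral by metis
  show ?thesis
    using that[OF spectral_resolution_similar(1)[OF LE(1) QV(2,1)] LE(3)]
      spectral_resolution_similar(2)[OF LE(1) QV(2,1)] LE(2)
    by (simp add: matrix_inv_mult_geom_mean[OF assms] V_def Q_def)
qed

lemma pos_eig_sqrt_eq:
  assumes "pos_def_mat A" "pos_def_mat B"
  shows "pos_eig_sqrt (matrix_inv A ** B) = matrix_inv A ** geom_mean A B"
proof -
  obtain L E where LE: "spectral_resolution L E" "\<And>l. l \<in> L \<Longrightarrow> 0 < l"
    "matrix_inv A ** geom_mean A B = fcalc L E (\<lambda>l. l)"
    using matrix_inv_mult_geom_mean_spectral[OF assms] by metis
  show ?thesis
    using pos_eig_sqrt_fcalc[OF LE(1,2)] matrix_inv_mult_geom_mean_square[OF assms]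
    by (simp add: LE(3))
qed

section \<open>The derivative of the geometric mean\<close>

lemma has_vector_derivative_at_0I:
  fixes f :: "real \<Rightarrow> 'a::real_normed_vector"
  assumes "((\<lambda>h. (1 / h) *\<^sub>R (f h - f 0)) \<longlongrightarrow> D) (at 0)"
  shows "(f has_vector_derivative D) (at 0)"
proof -
  have "((\<lambda>h. norm ((1 / h) *\<^sub>R (f h - f 0) - D)) \<longlongrightarrow> 0) (at 0)"
    using assms by (intro tendsto_norm_zero) (simp add: LIM_zero)
  moreover have "eventually (\<lambda>h. norm ((1 / h) *\<^sub>R (f h - f 0) - D)
      = norm (f (0 + h) - f 0 - h *\<^sub>R D) / norm h) (at (0::real))"
  proof (rule eventually_at_filter[THEN iffD2], intro always_eventually allI impI)
    fix h :: real assume "h \<noteq> 0"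
    then have "(1 / h) *\<^sub>R (f h - f 0) - D = (1 / h) *\<^sub>R (f h - f 0 - h *\<^sub>R D)"
      by (simp add: scaleR_diff_right)
    then show "norm ((1 / h) *\<^sub>R (f h - f 0) - D) = norm (f (0 + h) - f 0 - h *\<^sub>R D) / norm h"
      by simp
  qed
  ultimately have "((\<lambda>h. norm (f (0 + h) - f 0 - h *\<^sub>R D) / norm h) \<longlongrightarrow> 0) (at 0)"
    by (rule Lim_transform_eventually)
  then show ?thesis
    by (simp add: has_vector_derivative_def has_derivative_at bounded_linear_scaleR_left)
qed

lemma geom_mean_tendsto:
  assumes M: "(M \<longlongrightarrow> A) F" "eventually (\<lambda>t. pos_def_mat (M t)) F" "pos_def_mat A"
    and K: "(K \<longlongrightarrow> B) F" "eventually (\<lambda>t. pos_def_mat (K t)) F" "pos_def_mat B"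
  shows "((\<lambda>t. geom_mean (M t) (K t)) \<longlongrightarrow> geom_mean A B) F"
proof -
  have Q: "((\<lambda>t. pd_sqrt (M t)) \<longlongrightarrow> pd_sqrt A) F"
    by (rule pd_sqrt_tendsto[OF M])
  have V: "((\<lambda>t. matrix_inv (pd_sqrt (M t))) \<longlongrightarrow> matrix_inv (pd_sqrt A)) F"
  proof (rule matrix_inv_tendsto[OF Q])
    show "eventually (\<lambda>t. invertible (pd_sqrt (M t))) F"
      using M(2) by eventually_elim (rule invertible_pd_sqrt)
    show "invertible (pd_sqrt A)" by (rule invertible_pd_sqrt[OF M(3)])
  qed
  have "((\<lambda>t. pd_sqrt (matrix_inv (pd_sqrt (M t)) ** K t ** matrix_inv (pd_sqrt (M t)))) \<longlongrightarrow>
      pd_sqrt (matrix_inv (pd_sqrt A) ** B ** matrix_inv (pd_sqrt A))) F"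
  proof (rule pd_sqrt_tendsto)
    show "((\<lambda>t. matrix_inv (pd_sqrt (M t)) ** K t ** matrix_inv (pd_sqrt (M t))) \<longlongrightarrow>
        matrix_inv (pd_sqrt A) ** B ** matrix_inv (pd_sqrt A)) F"
      by (intro mm.tendsto V K)
    show "eventually (\<lambda>t. pos_def_mat (matrix_inv (pd_sqrt (M t)) ** K t ** matrix_inv (pd_sqrt (M t)))) F"
      using M(2) K(2) by eventually_elim (rule pos_def_geom_mean_inner)
    show "pos_def_mat (matrix_inv (pd_sqrt A) ** B ** matrix_inv (pd_sqrt A))"
      by (rule pos_def_geom_mean_inner[OF M(3) K(3)])
  qed
  then show ?thesis unfolding geom_mean_def by (intro mm.tendsto Q)
qed

lemma linear_sylvester: "linear (\<lambda>X. S ** X + X ** T)" for S T :: "complex^'n^'n"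
  by (intro linear_compose_add bounded_linear.linear mm.bounded_linear_right mm.bounded_linear_left)

text \<open>Multiplying the homogeneous equation by the adjoint of E l on the left and by E m on the
  right turns the operator into the scalar \<open>l + m\<close>, which is positive; so every block
  of X vanishes.\<close>

lemma sylvester_injective:
  assumes res: "spectral_resolution L E" and pos: "\<And>l. l \<in> L \<Longrightarrow> 0 < l" and S: "S = fcalc L E (\<lambda>l. l)"
  shows "inj (\<lambda>X. conj_transpose S ** X + X ** S)"
proof -
  note D = spectral_resolutionD[OF res]
  have "X = 0" if X: "conj_transpose S ** X + X ** S = 0" for X
  proof -
    have zero: "conj_transpose (E l) ** X ** E m = 0" if l: "l \<in> L" and m: "m \<in> L" for l m
    proof -
      have "conj_transpose (E l) ** conj_transpose S = l *\<^sub>R conj_transpose (E l)"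
        using fcalc_mult_projection(1)[OF res l, of "\<lambda>l. l"]
        by (simp add: S conj_transpose_scaleR flip: conj_transpose_mult)
      moreover have "S ** E m = m *\<^sub>R E m"
        using fcalc_mult_projection(1)[OF res m] by (simp add: S)
      moreover have "conj_transpose (E l) ** (conj_transpose S ** X + X ** S) ** E m =
          (conj_transpose (E l) ** conj_transpose S) ** X ** E m + conj_transpose (E l) ** X ** (S ** E m)"
        by (simp add: mm.add_left mm.add_right matrix_mul_assoc)
      ultimately have "(l + m) *\<^sub>R (conj_transpose (E l) ** X ** E m) = 0"
        by (simp add: X mm.scaleR_left mm.scaleR_right scaleR_add_left)
      then show ?thesis using pos[OF l] pos[OF m] by simp
    qed
    have "X = conj_transpose (\<Sum>l\<in>L. E l) ** X ** (\<Sum>m\<in>L. E m)" by (simp add: D(2))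
    also have "\<dots> = (\<Sum>l\<in>L. \<Sum>m\<in>L. conj_transpose (E l) ** X ** E m)"
      unfolding conj_transpose_sum by (subst sum.swap) (simp add: mm.sum_left mm.sum_right)
    finally show ?thesis by (simp add: zero)
  qed
  then show ?thesis using linear_injective_0[OF linear_sylvester[of "conj_transpose S" S]] by blast
qed

text \<open>Convergence of q is a conclusion here. A left inverse of f first gives boundedness, the
  perturbation being absorbed into the left side; then the perturbation tends to 0, f (q t)
  converges, and applying the left inverse yields the limit of q.\<close>

lemma tendsto_of_perturbed_linear_equation:
  fixes f :: "'a::euclidean_space \<Rightarrow> 'a" and q :: "'b \<Rightarrow> 'a"
  assumes lin: "linear f" "inj f" and bb: "bounded_bilinear p"
    and eq: "eventually (\<lambda>t. f (q t) + p (q t) (u t) = r t) F"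
    and u: "(u \<longlongrightarrow> (0::'c::real_normed_vector)) F" and r: "(r \<longlongrightarrow> R) F" and F: "F \<noteq> bot"
  obtains D where "(q \<longlongrightarrow> D) F" "f D = R"
proof -
  interpret bounded_bilinear p by fact
  obtain g where g: "linear g" "g \<circ> f = id"
    using linear_injective_left_inverse[OF lin] by blast
  obtain K where K: "K > 0" "\<And>x. norm (g x) \<le> norm x * K"
    using bounded_linear.pos_bounded g(1) by (metis linear_conv_bounded_linear)
  obtain c where c: "c > 0" "\<And>x y. norm (p x y) \<le> norm x * norm y * c"
    using pos_bounded by blast
  have u0: "((\<lambda>t. norm (u t)) \<longlongrightarrow> 0) F" using u by (rule tendsto_norm_zero)
  \<comment> \<open>With this threshold the perturbation, after applying g, contributes at most half
    of \<open>norm (q t)\<close>.\<close>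
  have "eventually (\<lambda>t. norm (u t) < 1 / (2 * K * c)) F"
    using u0 by (rule order_tendstoD) (use K c in simp)
  moreover have "eventually (\<lambda>t. norm (r t) < norm R + 1) F"
    using tendsto_norm[OF r] by (rule order_tendstoD) simp
  ultimately have q_bound: "eventually (\<lambda>t. norm (q t) \<le> 2 * K * (norm R + 1)) F"
    using eq
  proof eventually_elim
    case (elim t)
    have "q t = g (r t - p (q t) (u t))"
      using elim(3) fun_cong[OF g(2), of "q t"] by (simp add: eq_diff_eq flip: elim(3))
    then have "norm (q t) \<le> (norm (r t) + norm (p (q t) (u t))) * K"
      using K(2)[of "r t - p (q t) (u t)"] norm_triangle_ineq4[of "r t" "p (q t) (u t)"] K(1)
      by (smt (verit) mult_right_mono)
    also have "\<dots> \<le> (norm R + 1 + norm (q t) * (1 / (2 * K))) * K"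
    proof (intro mult_right_mono add_mono)
      have "norm (p (q t) (u t)) \<le> norm (q t) * (norm (u t) * c)" using c(2) by (simp add: mult.assoc)
      also have "\<dots> \<le> norm (q t) * (1 / (2 * K))"
        using elim(1) K(1) c(1) by (intro mult_left_mono) (simp_all add: field_simps)
      finally show "norm (p (q t) (u t)) \<le> norm (q t) * (1 / (2 * K))" .
    qed (use elim(2) K(1) in auto)
    also have "\<dots> = K * (norm R + 1) + norm (q t) / 2"
      using K(1) by (simp add: field_simps)
    finally show ?case by (simp add: mult.assoc)
  qed
  have prod0: "((\<lambda>t. p (q t) (u t)) \<longlongrightarrow> 0) F"
  proof (rule Lim_null_comparison)
    show "((\<lambda>t. (2 * K * (norm R + 1) * c) * norm (u t)) \<longlongrightarrow> 0) F"
      by (rule tendsto_mult_right_zero[OF u0])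
    show "eventually (\<lambda>t. norm (p (q t) (u t)) \<le> (2 * K * (norm R + 1) * c) * norm (u t)) F"
      using q_bound
    proof eventually_elim
      case (elim t)
      have "norm (p (q t) (u t)) \<le> norm (q t) * (norm (u t) * c)" using c(2) by (simp add: mult.assoc)
      also have "\<dots> \<le> (2 * K * (norm R + 1)) * (norm (u t) * c)"
        using elim c(1) by (intro mult_right_mono) auto
      finally show ?case by (simp add: mult_ac)
    qed
  qed
  have rhs: "((\<lambda>t. r t - p (q t) (u t)) \<longlongrightarrow> R) F"
    using tendsto_diff[OF r prod0] by simp
  have fq: "((\<lambda>t. f (q t)) \<longlongrightarrow> R) F"
    by (rule Lim_transform_eventually[OF rhs]) (use eq in \<open>auto elim!: eventually_mono simp: algebra_simps\<close>)
  have bl: "bounded_linear f" "bounded_linear g"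
    using lin(1) g(1) by (simp_all add: linear_conv_bounded_linear)
  have "((\<lambda>t. g (f (q t))) \<longlongrightarrow> g R) F"
    by (rule bounded_linear.tendsto[OF bl(2) fq])
  moreover have "g (f x) = x" for x using fun_cong[OF g(2), of x] by simp
  ultimately have q: "(q \<longlongrightarrow> g R) F" by simp
  then have "((\<lambda>t. f (q t)) \<longlongrightarrow> f (g R)) F"
    by (rule bounded_linear.tendsto[OF bl(1)])
  \<comment> \<open>Since g was chosen only as a left inverse, this equation comes from uniqueness
    of limits.\<close>
  then have "f (g R) = R" using tendsto_unique[OF F _ fq] by blast
  then show ?thesis using that q by blast
qed

theorem geom_mean_has_vector_derivative:
  fixes A B X Y :: "complex^'n^'n"
  assumes A: "pos_def_mat A" and B: "pos_def_mat B" and X: "hermitian_mat X" and Y: "hermitian_mat Y"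
    and S: "S = matrix_inv A ** geom_mean A B"
  obtains D where "((\<lambda>t. geom_mean (A + t *\<^sub>R X) (B + t *\<^sub>R Y)) has_vector_derivative D) (at 0)"
    "conj_transpose S ** D + D ** S = Y + conj_transpose S ** X ** S"
proof -
  define a where "a t = A + t *\<^sub>R X" for t
  define b where "b t = B + t *\<^sub>R Y" for t
  define G where "G t = geom_mean (a t) (b t)" for t
  define s where "s t = matrix_inv (a t) ** G t" for t
  have ab0: "a 0 = A" "b 0 = B" by (simp_all add: a_def b_def)
  have S0: "s 0 = S" by (simp add: s_def G_def ab0 S)
  have lim: "(a \<longlongrightarrow> A) (at 0)" "(b \<longlongrightarrow> B) (at 0)"
    unfolding a_def b_def by (auto intro!: tendsto_eq_intros)
  have pd: "eventually (\<lambda>t. pos_def_mat (a t)) (at 0)" "eventually (\<lambda>t. pos_def_mat (b t)) (at 0)"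
    by (intro eventually_pos_def[OF lim(1) _ A] eventually_pos_def[OF lim(2) _ B] always_eventually allI,
        use A B X Y in \<open>simp add: a_def b_def pos_def_mat_iff hermitian_mat_add hermitian_mat_scaleR\<close>)+
  have limG: "(G \<longlongrightarrow> G 0) (at 0)"
    using geom_mean_tendsto[OF lim(1) pd(1) A lim(2) pd(2) B] by (simp add: G_def[abs_def] ab0)
  have "((\<lambda>t. matrix_inv (a t)) \<longlongrightarrow> matrix_inv A) (at 0)"
    by (rule matrix_inv_tendsto[OF lim(1) _ pos_def_invertible[OF A]])
      (rule eventually_mono[OF pd(1) pos_def_invertible])
  then have lims: "(s \<longlongrightarrow> S) (at 0)"
    unfolding s_def[abs_def] S0[symmetric] s_def ab0 by (intro mm.tendsto limG)
  define q where "q t = (1 / t) *\<^sub>R (G t - G 0)" for t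
  have G0: "conj_transpose S = G 0 ** matrix_inv A"
  proof -
    have "conj_transpose (matrix_inv A) = matrix_inv A" "conj_transpose (G 0) = G 0"
      using hermitian_mat_inv[OF _ pos_def_invertible[OF A]] pos_def_geom_mean[OF A B] A
      by (simp_all add: pos_def_mat_iff hermitian_mat_def G_def ab0)
    then show ?thesis by (simp add: S conj_transpose_mult G_def ab0)
  qed
  have "eventually (\<lambda>t. t \<noteq> 0) (at (0::real))" by (simp add: eventually_at_filter)
  \<comment> \<open>The product \<open>q t ** s t\<close> is split as
    \<open>q t ** S + q t ** (s t - S)\<close>, which isolates the Sylvester operator and leaves a
    bilinear perturbation whose second argument tends to 0.\<close>
  then have eq: "eventually (\<lambda>t. (conj_transpose S ** q t + q t ** S) + q t ** (s t - S)
      = Y + conj_transpose S ** X ** s t) (at 0)"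
    using pd
  proof eventually_elim
    case (elim t)
    have Ai: "matrix_inv A - matrix_inv (a t) = t *\<^sub>R (matrix_inv A ** X ** matrix_inv (a t))"
      using matrix_inv_diff[OF pos_def_invertible[OF elim(2)] pos_def_invertible[OF A]]
      by (simp add: a_def mm.scaleR_left mm.scaleR_right mm.minus_left mm.minus_right algebra_simps)
    have ric: "G t ** matrix_inv (a t) ** G t = B + t *\<^sub>R Y" "G 0 ** matrix_inv A ** G 0 = B"
      using geom_mean_riccati[OF elim(2,3)] geom_mean_riccati[OF A B] by (simp_all add: G_def ab0 b_def)
    \<comment> \<open>The mixed product of G 0, the inverse of A and G t is added and subtracted
      between the two Riccati equations. Using S on one side and s t on the other makes the identity
      exact, with no second-order remainder.\<close>
    have "conj_transpose S ** (G t - G 0) + (G t - G 0) ** s t =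
        (G t ** matrix_inv (a t) ** G t - G 0 ** matrix_inv A ** G 0)
        + G 0 ** (matrix_inv A - matrix_inv (a t)) ** G t"
      by (simp add: G0 s_def mm.diff_left mm.diff_right matrix_mul_assoc)
    also have "\<dots> = t *\<^sub>R (Y + conj_transpose S ** X ** s t)"
      unfolding ric Ai G0 s_def
      by (simp add: mm.scaleR_left mm.scaleR_right scaleR_add_right matrix_mul_assoc)
    finally have "conj_transpose S ** q t + q t ** s t = Y + conj_transpose S ** X ** s t"
      using elim(1) by (simp add: q_def mm.scaleR_left mm.scaleR_right flip: scaleR_add_right)
    then show ?case by (simp add: mm.diff_right)
  qed
  obtain L E where LE: "spectral_resolution L E" "\<And>l. l \<in> L \<Longrightarrow> 0 < l" "S = fcalc L E (\<lambda>l. l)"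
    using matrix_inv_mult_geom_mean_spectral[OF A B] unfolding S by metis
  have s0: "((\<lambda>t. s t - S) \<longlongrightarrow> 0) (at 0)" using lims by (simp add: LIM_zero)
  have r: "((\<lambda>t. Y + conj_transpose S ** X ** s t) \<longlongrightarrow> Y + conj_transpose S ** X ** S) (at 0)"
    by (intro tendsto_intros mm.tendsto lims)
  obtain D where D: "(q \<longlongrightarrow> D) (at 0)" "conj_transpose S ** D + D ** S = Y + conj_transpose S ** X ** S"
    by (rule tendsto_of_perturbed_linear_equation[OF linear_sylvester sylvester_injective[OF LE]
          bounded_bilinear_matrix_mult eq s0 r trivial_limit_at])
  have "(G has_vector_derivative D) (at 0)"
    using D(1) unfolding q_def by (rule has_vector_derivative_at_0I)
  then show ?thesis using that D(2) by (simp add: G_def[abs_def] a_def b_def)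
qed

theorem corollary2p2:
  fixes N :: "complex^'n^'n \<Rightarrow> real" and A B :: "complex^'n^'n"
  assumes "unitarily_invariant_norm N"
    and "pos_def_mat A" and "pos_def_mat B"
  shows "mat_deriv_norm N geom_mean A B
    \<le> integral {0..} (\<lambda>t::real.
          (op_norm (mat_exp ((- t) *\<^sub>R pos_eig_sqrt (matrix_inv A ** B))))\<^sup>2)
      * (1 + (op_norm (pos_eig_sqrt (matrix_inv A ** B)))\<^sup>2)"
proof -
  define S where "S = matrix_inv A ** geom_mean A B"
  define J where "J = integral {0..} (\<lambda>t::real. (op_norm (mat_exp ((- t) *\<^sub>R S)))\<^sup>2)"
  have MN: "matrix_norm N" using assms(1) by (simp add: unitarily_invariant_norm_def)
  note P = matrix_norm_props[OF MN]
  obtain L E where LE: "spectral_resolution L E" "\<And>l. l \<in> L \<Longrightarrow> 0 < l" "S = fcalc L E (\<lambda>l. l)"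
    using matrix_inv_mult_geom_mean_spectral[OF assms(2,3)] unfolding S_def by metis
  \<comment> \<open>A nonnegative integrand has a nonnegative integral, and in the non-integrable
    case the default value 0 serves as well.\<close>
  have J: "0 \<le> J"
    unfolding J_def by (cases "(\<lambda>t::real. (op_norm (mat_exp ((- t) *\<^sub>R S)))\<^sup>2) integrable_on {0..}")
      (simp_all add: integral_nonneg not_integrable_integral)
  have inv: "invertible S"
    unfolding S_def by (intro invertible_mult invertible_matrix_inv pos_def_invertible pos_def_geom_mean assms)
  have bound: "N (mat_deriv geom_mean A B X Y) \<le> J * (1 + (op_norm S)\<^sup>2)"
    if XY: "hermitian_mat X" "hermitian_mat Y" "max (N X) (N Y) = 1" for X Y
  proof -
    obtain D where D: "((\<lambda>t. geom_mean (A + t *\<^sub>R X) (B + t *\<^sub>R Y)) has_vector_derivative D) (at 0)"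
      "conj_transpose S ** D + D ** S = Y + conj_transpose S ** X ** S"
      by (rule geom_mean_has_vector_derivative[OF assms(2,3) XY(1,2) S_def])
    have "N D \<le> J * N (Y + conj_transpose S ** X ** S)"
      using sylvester_norm_bound[OF assms(1) LE, of D] unfolding D(2) J_def .
    also have "\<dots> \<le> J * (1 + (op_norm S)\<^sup>2)"
    proof (rule mult_left_mono[OF _ J])
      have "N (Y + conj_transpose S ** X ** S) \<le> N Y + (op_norm S)\<^sup>2 * N X"
        using P(4)[of Y "conj_transpose S ** X ** S"]
          unitarily_invariant_norm_congruence[OF assms(1) inv, of X] by linarith
      also have "\<dots> \<le> 1 + (op_norm S)\<^sup>2 * 1"
        using XY(3) by (intro add_mono mult_left_mono) auto
      finally show "N (Y + conj_transpose S ** X ** S) \<le> 1 + (op_norm S)\<^sup>2" by simp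
    qed
    finally show ?thesis
      unfolding mat_deriv_def vector_derivative_at[OF D(1)] .
  qed
  \<comment> \<open>A supremum of reals is bounded by upper bounds of the set only when the set is
    nonempty; the identity scaled to norm 1 provides an admissible direction.\<close>
  have N1: "N (mat 1) > 0" using P(1,2)[of "mat 1"] mat_1_neq_0 by (metis order_le_less)
  define X :: "complex^'n^'n" where "X = (1 / N (mat 1)) *\<^sub>R mat 1"
  have "hermitian_mat X" "N X = 1"
    using N1 by (simp_all add: X_def hermitian_mat_def conj_transpose_scaleR P(3))
  then have "{N (mat_deriv geom_mean A B X Y) | X Y.
      hermitian_mat X \<and> hermitian_mat Y \<and> max (N X) (N Y) = 1} \<noteq> {}"
    by (simp add: exI[of _ X])
  then show ?thesis
    unfolding mat_deriv_norm_def pos_eig_sqrt_eq[OF assms(2,3)] S_def[symmetric] J_def[symmetric]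
    by (rule cSup_least) (use bound in blast)
qed

end
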